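(* Let $H(y)=\frac12 y^{\intercal}My+V(y)$ and consider the system $y'(t)=Q\nabla H(y(t))$, $y(0)=y_0\in\mathbb{R}^d$, where $Q$ is an invertible real $d\times d$ matrix, $M$ is a symmetric real $d\times d$ matrix and $V:\mathbb{R}^d\to\mathbb{R}$ is differentiable. Let $\tilde u$ be the solution, and $y_1=\tilde u(1)$ the result, of one step of size $h$ of the ECr method from $y_0$. Suppose $Q$ is negative semidefinite (i.e. $x^{\intercal}Qx\le0$ for all $x\in\mathbb{R}^d$), so that $H$ is a Lyapunov function of the system. (i) If $\tilde u\in X_h$, then the method preserves the Lyapunov function: $H(y_1)\le H(y_0)$. (ii) If $\tilde u\notin X_h$, then $H(y_1)\le H(y_0)+\mathcal{O}(h^{2r+1})$ as $h\to0$.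
   Context: Put $A=QM$ and $g(y)=Q\nabla V(y)$, so the system reads $y'=Ay+g(y)$. Function spaces. Fix an integer $r\ge1$ and fixed ($h$-independent) sufficiently smooth real functions $\varphi_0,\dots,\varphi_{r-1}$ of time. For a stepsize $h>0$ and any function $\varphi$ write $\tilde\varphi(\tau)=\varphi(\tau h)$, $\tau\in[0,1]$. The functions $\tilde\varphi_0,\dots,\tilde\varphi_{r-1}$ are assumed linearly independent on $[0,1]$. Define $$Y_h=\Big\{\tilde w:\ \tilde w(\tau)=\sum_{i=0}^{r-1}\tilde\varphi_i(\tau)W_i,\ \tau\in[0,1],\ W_i\in\mathbb{R}^d\Big\}.$$ $X_h$ is a finite-dimensional space of $\mathbb{R}^d$-valued functions on $[0,1]$ such that $\tilde w'\in Y_h$ for every $\tilde w\in X_h$. A prime on a tilde function is the time derivative: if $\tilde w(\tau)=w(\tau h)$, then $\tilde w'(\tau)=w'(\tau h)$, i.e. $\frac{d}{d\tau}\tilde w=h\tilde w'$. Let $\langle w_1,w_2\rangle=\int_0^1 w_1(\tau)\cdot w_2(\tau)\,d\tau$, let $\tilde\psi_0,\dots,\tilde\psi_{r-1}$ be an orthonormal basis of $\mathrm{span}\{\tilde\varphi_0,\dots,\tilde\varphi_{r-1}\}$ for this inner product, and $P_{\tau,\sigma}=\sum_{i=0}^{r-1}\tilde\psi_i(\tau)\tilde\psi_i(\sigma)$. The orthogonal projection onto $Y_h$ is $\mathcal{P}_h\tilde w(\tau)=\int_0^1P_{\tau,\sigma}\tilde w(\sigma)\,d\sigma$. ECr method.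 One step of size $h$ from $y_0$ is $$\tilde u(\tau)=e^{\tau hA}y_0+\tau h\int_0^1\bar A_{\tau,\sigma}(A)\,g(\tilde u(\sigma))\,d\sigma,\qquad y_1=\tilde u(1),$$ $$\bar A_{\tau,\sigma}(A)=\int_0^1e^{(1-\xi)\tau hA}P_{\xi\tau,\sigma}\,d\xi .$$ Equivalently $\tilde u(0)=y_0$ and $\tilde u'(\tau)=A\tilde u(\tau)+\mathcal{P}_hg(\tilde u(\tau))$. Conventions for the $\mathcal{O}$-statement. $V$ is sufficiently smooth (e.g. $C^\infty$). For sufficiently small $h$, $\tilde u$ is the unique solution with values in a ball of fixed radius about $e^{\tau hA}y_0$; it depends smoothly on $h$. An $h$-dependent function $w(\tau)$ is called regular if $w(\tau)=\sum_{n=0}^{r-1}w^{[n]}(\tau)h^n+\mathcal{O}(h^r)$ with each $w^{[n]}(\tau)=\frac1{n!}\frac{\partial^n w(\tau)}{\partial h^n}\big|_{h=0}$ having polynomial entries in $\tau$ of degree $\le n$. The spaces $Y_h$ have the following properties, recalled from the literature: $P_{\tau,\sigma}$ extends smoothly in $h$ to $h=0$ by its limit, and $\mathcal{P}_hw-w=\mathcal{O}(h^r)$ for every regular $w$. *)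

theory Defs
  imports "HOL-Analysis.Analysis" "HOL-Library.Landau_Symbols"
    "HOL-Computational_Algebra.Polynomial"
begin

definition grad :: "('a::euclidean_space \<Rightarrow> real) \<Rightarrow> 'a \<Rightarrow> 'a" where
  "grad V y = (THE D. GDERIV V y :> D)"

definition energy :: "real^'d^'d \<Rightarrow> (real^'d \<Rightarrow> real) \<Rightarrow> real^'d \<Rightarrow> real" where
  "energy M V y = 1/2 * (y \<bullet> (M *v y)) + V y"

lemma GDERIV_grad:
  fixes V :: "'a::euclidean_space \<Rightarrow> real"
  assumes "V differentiable (at y)"
  shows "GDERIV V y :> grad V y"
proof -
  obtain L where L: "(V has_derivative L) (at y)"
    using assms by (auto simp: differentiable_def)
  then interpret L: linear L
    by (rule has_derivative_linear)
  define D where "D = (\<Sum>b\<in>Basis. L b *\<^sub>R b)"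
  have "L x = x \<bullet> D" for x
  proof -
    have "L x = L (\<Sum>b\<in>Basis. (x \<bullet> b) *\<^sub>R b)"
      by (simp add: euclidean_representation)
    also have "\<dots> = x \<bullet> D"
      by (simp add: D_def L.sum L.scaleR inner_sum_right mult.commute)
    finally show ?thesis .
  qed
  then have "L = (\<lambda>x. x \<bullet> D)"
    by (rule ext)
  then have D: "GDERIV V y :> D"
    using L by (simp only: gderiv_def)
  moreover have "E = D" if "GDERIV V y :> E" for E
  proof -
    have "(\<lambda>x. x \<bullet> E) = (\<lambda>x. x \<bullet> D)"
      using that D unfolding gderiv_def by (rule has_derivative_unique)
    then show ?thesis
      using vector_eq_ldot by metis
  qed
  ultimately show ?thesis
    unfolding grad_def by (rule theI)
qed

text \<open>The equation \<open>y' = Q \<nabla>H(y)\<close> reads \<open>y' = A y + g(y)\<close> with \<open>A = Q M\<close> and \<open>g = Q \<nabla>V\<close>.\<close>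

lemma grad_energy:
  fixes M :: "real^'d^'d"
  assumes "transpose M = M" and "V differentiable (at y)"
  shows "grad (energy M V) y = M *v y + grad V y"
proof -
  have V: "(V has_derivative (\<lambda>x. x \<bullet> grad V y)) (at y)"
    using GDERIV_grad[OF assms(2)] by (simp add: gderiv_def)
  have M: "((*v) M has_derivative (*v) M) (at y)"
    by (rule bounded_linear_imp_has_derivative) simp
  have sym: "y \<bullet> (M *v x) = x \<bullet> (M *v y)" for x
    by (metis assms(1) dot_lmul_matrix inner_commute transpose_matrix_vector)
  have "(energy M V has_derivative
      (\<lambda>x. 1/2 * (y \<bullet> (M *v x) + x \<bullet> (M *v y)) + x \<bullet> grad V y)) (at y)"
    unfolding energy_def[abs_def]
    by (intro has_derivative_add V has_derivative_mult_right
        has_derivative_inner[OF has_derivative_ident M])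
  then have D: "GDERIV (energy M V) y :> M *v y + grad V y"
    unfolding gderiv_def by (rule has_derivative_eq_rhs) (simp only: sym inner_add_right, simp)
  then have "energy M V differentiable (at y)"
    by (auto simp: gderiv_def differentiable_def)
  from GDERIV_grad[OF this] D
  have "(\<lambda>x. x \<bullet> grad (energy M V) y) = (\<lambda>x. x \<bullet> (M *v y + grad V y))"
    unfolding gderiv_def by (rule has_derivative_unique)
  then show ?thesis
    using vector_eq_ldot by metis
qed

lemma system_splitting:
  fixes Q M :: "real^'d^'d"
  assumes "transpose M = M" and "V differentiable (at y)"
  shows "Q *v grad (energy M V) y = (Q ** M) *v y + Q *v grad V y"
  by (simp add: grad_energy[OF assms] matrix_vector_right_distrib matrix_vector_mul_assoc)

text \<open>\<open>C\<^sup>k\<close> by directional derivatives, which in finite dimension is the usual notion. On sets such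
  as a half line the derivatives at boundary points are one-sided.\<close>

primrec Ck_on :: "nat \<Rightarrow> 'a::euclidean_space set \<Rightarrow> ('a \<Rightarrow> 'b::real_normed_vector) \<Rightarrow> bool" where
  "Ck_on 0 = (\<lambda>S f. continuous_on S f)"
| "Ck_on (Suc k) = (\<lambda>S f. \<exists>f'. (\<forall>x\<in>S. (f has_derivative f' x) (at x within S)) \<and>
     (\<forall>v. Ck_on k S (\<lambda>x. f' x v)))"

definition Cinf_on :: "'a::euclidean_space set \<Rightarrow> ('a \<Rightarrow> 'b::real_normed_vector) \<Rightarrow> bool" where
  "Cinf_on S f \<longleftrightarrow> (\<forall>k. Ck_on k S f)"

text \<open>Functions on \<open>[0,1]\<close> are total functions of which only the values on \<open>{0..1}\<close> matter: the
  sets of functions below are closed under changes outside \<open>{0..1}\<close>.\<close>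

definition fspan :: "nat \<Rightarrow> (nat \<Rightarrow> real \<Rightarrow> 'a::real_vector) \<Rightarrow> (real \<Rightarrow> 'a) set" where
  "fspan m b = {w. \<exists>c::nat \<Rightarrow> real. \<forall>\<tau>\<in>{0..1}. w \<tau> = (\<Sum>j<m. c j *\<^sub>R b j \<tau>)}"

definition rescale :: "real \<Rightarrow> (real \<Rightarrow> 'a) \<Rightarrow> real \<Rightarrow> 'a" where
  "rescale h f \<tau> = f (\<tau> * h)"

definition lin_indep :: "nat \<Rightarrow> (nat \<Rightarrow> real \<Rightarrow> real) \<Rightarrow> bool" where
  "lin_indep m b \<longleftrightarrow>
    (\<forall>c::nat \<Rightarrow> real. (\<forall>\<tau>\<in>{0..1}. (\<Sum>j<m. c j * b j \<tau>) = 0) \<longrightarrow> (\<forall>j<m. c j = 0))"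

definition Yspace :: "nat \<Rightarrow> (nat \<Rightarrow> real \<Rightarrow> real) \<Rightarrow> real \<Rightarrow> (real \<Rightarrow> real^'d) set" where
  "Yspace r \<phi> h =
    {w. \<exists>W::nat \<Rightarrow> real^'d. \<forall>\<tau>\<in>{0..1}. w \<tau> = (\<Sum>i<r. rescale h (\<phi> i) \<tau> *\<^sub>R W i)}"

text \<open>The function \<open>v\<close> below is the time derivative of \<open>w\<close>, so that \<open>dw/d\<tau> = h v\<close>.\<close>

definition is_Xspace ::
    "nat \<Rightarrow> (nat \<Rightarrow> real \<Rightarrow> real) \<Rightarrow> real \<Rightarrow> (real \<Rightarrow> real^'d) set \<Rightarrow> bool" where
  "is_Xspace r \<phi> h X \<longleftrightarrow> (\<exists>m b. X = fspan m b) \<and>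
    (\<forall>w\<in>X. \<exists>v\<in>Yspace r \<phi> h. \<forall>\<tau>\<in>{0..1}.
      (w has_vector_derivative h *\<^sub>R v \<tau>) (at \<tau> within {0..1}))"

definition L2_inner :: "(real \<Rightarrow> 'a::real_inner) \<Rightarrow> (real \<Rightarrow> 'a) \<Rightarrow> real" where
  "L2_inner w1 w2 = integral {0..1} (\<lambda>\<tau>. w1 \<tau> \<bullet> w2 \<tau>)"

definition orthonormal_basis ::
    "nat \<Rightarrow> (nat \<Rightarrow> real \<Rightarrow> real) \<Rightarrow> real \<Rightarrow> (nat \<Rightarrow> real \<Rightarrow> real) \<Rightarrow> bool" where
  "orthonormal_basis r \<phi> h \<psi> \<longleftrightarrow>
    fspan r \<psi> = fspan r (\<lambda>i. rescale h (\<phi> i)) \<and>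
    (\<forall>i<r. \<forall>j<r. L2_inner (\<psi> i) (\<psi> j) = (if i = j then 1 else 0))"

definition kernel :: "nat \<Rightarrow> (nat \<Rightarrow> real \<Rightarrow> real) \<Rightarrow> real \<Rightarrow> real \<Rightarrow> real" where
  "kernel r \<psi> \<tau> \<sigma> = (\<Sum>i<r. \<psi> i \<tau> * \<psi> i \<sigma>)"

definition proj :: "nat \<Rightarrow> (nat \<Rightarrow> real \<Rightarrow> real) \<Rightarrow> (real \<Rightarrow> real^'d) \<Rightarrow> real \<Rightarrow> real^'d" where
  "proj r \<psi> w \<tau> = integral {0..1} (\<lambda>\<sigma>. kernel r \<psi> \<tau> \<sigma> *\<^sub>R w \<sigma>)"

text \<open>The multiplication of the type \<open>real^'d^'d\<close> is componentwise, so the library's \<open>exp\<close> is not the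
  matrix exponential.\<close>

definition mexp :: "real^'d^'d \<Rightarrow> real^'d^'d" where
  "mexp A = (\<Sum>n. (1 / fact n) *\<^sub>R ((\<lambda>B. A ** B) ^^ n) (mat 1))"

definition Abar ::
    "nat \<Rightarrow> (nat \<Rightarrow> real \<Rightarrow> real) \<Rightarrow> real \<Rightarrow> real^'d^'d \<Rightarrow> real \<Rightarrow> real \<Rightarrow> real^'d^'d" where
  "Abar r \<psi> h A \<tau> \<sigma> =
    integral {0..1} (\<lambda>\<xi>. kernel r \<psi> (\<xi> * \<tau>) \<sigma> *\<^sub>R mexp (((1 - \<xi>) * \<tau> * h) *\<^sub>R A))"

text \<open>The first conjunct says that the integrals over \<open>\<sigma>\<close> in the method and in the projection of
  \<open>g \<circ> u\<close> exist. It holds automatically if \<open>g\<close> and \<open>u\<close> are continuous, but \<open>g = Q \<nabla>V\<close> need not be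
  continuous when \<open>V\<close> is only differentiable.\<close>

definition ECr_solution ::
    "nat \<Rightarrow> (nat \<Rightarrow> real \<Rightarrow> real) \<Rightarrow> real \<Rightarrow> real^'d^'d \<Rightarrow> (real^'d \<Rightarrow> real^'d) \<Rightarrow> real^'d
      \<Rightarrow> (real \<Rightarrow> real^'d) \<Rightarrow> bool" where
  "ECr_solution r \<psi> h A g y0 u \<longleftrightarrow>
    (\<forall>i<r. (\<lambda>\<sigma>. \<psi> i \<sigma> *\<^sub>R g (u \<sigma>)) integrable_on {0..1}) \<and>
    (\<forall>\<tau>\<in>{0..1}. u \<tau> = mexp ((\<tau> * h) *\<^sub>R A) *v y0
      + (\<tau> * h) *\<^sub>R integral {0..1} (\<lambda>\<sigma>. Abar r \<psi> h A \<tau> \<sigma> *v g (u \<sigma>)))"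

definition unif_bigo :: "nat \<Rightarrow> (real \<Rightarrow> real \<Rightarrow> 'a::real_normed_vector) \<Rightarrow> bool" where
  "unif_bigo n f \<longleftrightarrow> (\<exists>C. \<forall>\<^sub>F h in at_right 0. \<forall>\<tau>\<in>{0..1}. norm (f h \<tau>) \<le> C * h ^ n)"

definition poly_entries :: "nat \<Rightarrow> (real \<Rightarrow> real^'d) \<Rightarrow> bool" where
  "poly_entries n f \<longleftrightarrow>
    (\<forall>k. \<exists>p::real poly. degree p \<le> n \<and> (\<forall>\<tau>\<in>{0..1}. f \<tau> $ k = poly p \<tau>))"

text \<open>\<open>D n\<close> is the \<open>n\<close>-th partial derivative of \<open>w\<close> in \<open>h\<close>, one-sided at \<open>h = 0\<close>. Continuity in \<open>\<tau>\<close>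
  makes the projection of \<open>w\<close> well defined.\<close>

definition regular :: "nat \<Rightarrow> (real \<Rightarrow> real \<Rightarrow> real^'d) \<Rightarrow> bool" where
  "regular r w \<longleftrightarrow> (\<exists>h0>0. \<exists>D.
    (\<forall>h\<in>{0..h0}. continuous_on {0..1} (w h)) \<and>
    (\<forall>h\<in>{0..h0}. \<forall>\<tau>\<in>{0..1}. D 0 h \<tau> = w h \<tau>) \<and>
    (\<forall>n. Suc n < r \<longrightarrow> (\<forall>h\<in>{0..h0}. \<forall>\<tau>\<in>{0..1}.
      ((\<lambda>s. D n s \<tau>) has_vector_derivative D (Suc n) h \<tau>) (at h within {0..h0}))) \<and>
    (\<forall>n<r. poly_entries n (\<lambda>\<tau>. (1 / fact n) *\<^sub>R D n 0 \<tau>)) \<and>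
    unif_bigo r (\<lambda>h \<tau>. w h \<tau> - (\<Sum>n<r. h ^ n *\<^sub>R ((1 / fact n) *\<^sub>R D n 0 \<tau>))))"

text \<open>Smoothness in \<open>h\<close> up to \<open>h = 0\<close> means that all derivatives in \<open>h\<close> are continuous in
  \<open>(h,\<tau>,\<sigma>)\<close>. By continuity \<open>D 0 0 \<tau> \<sigma>\<close> is the limit of the kernels as \<open>h\<close> tends to \<open>0\<close>.\<close>

definition kernel_extends_smoothly :: "nat \<Rightarrow> (real \<Rightarrow> nat \<Rightarrow> real \<Rightarrow> real) \<Rightarrow> bool" where
  "kernel_extends_smoothly r \<psi> \<longleftrightarrow> (\<exists>h0>0. \<exists>D.
    (\<forall>h\<in>{0<..h0}. \<forall>\<tau>\<in>{0..1}. \<forall>\<sigma>\<in>{0..1}. D 0 h \<tau> \<sigma> = kernel r (\<psi> h) \<tau> \<sigma>) \<and>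
    (\<forall>n. continuous_on ({0..h0} \<times> {0..1} \<times> {0..1}) (\<lambda>(h, \<tau>, \<sigma>). D n h \<tau> \<sigma>)) \<and>
    (\<forall>n. \<forall>h\<in>{0..h0}. \<forall>\<tau>\<in>{0..1}. \<forall>\<sigma>\<in>{0..1}.
      ((\<lambda>s. D n s \<tau> \<sigma>) has_real_derivative D (Suc n) h \<tau> \<sigma>) (at h within {0..h0})))"

definition projection_accurate ::
    "'d::finite itself \<Rightarrow> nat \<Rightarrow> (real \<Rightarrow> nat \<Rightarrow> real \<Rightarrow> real) \<Rightarrow> bool" where
  "projection_accurate _ r \<psi> \<longleftrightarrow> (\<forall>w::real \<Rightarrow> real \<Rightarrow> real^'d.
    regular r w \<longrightarrow> unif_bigo r (\<lambda>h \<tau>. proj r (\<psi> h) (w h) \<tau> - w h \<tau>))"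

end

theory Submission
  imports Defs
begin

text \<open>Along \<open>u' = h v\<close>, \<open>v = A u + P\<^sub>h g(u)\<close>, the energy changes by \<open>h \<integral> v \<sqdot> Q\<^sup>-\<^sup>1(A u + g(u))\<close>
  \<open>= h \<integral> v \<sqdot> Q\<^sup>-\<^sup>1 v + h \<integral> Q\<^sup>-\<^sup>T v \<sqdot> (g(u) - P\<^sub>h g(u))\<close>. The first term is nonpositive. The defect
  \<open>g(u) - P\<^sub>h g(u)\<close> is orthogonal to \<open>Y\<^sub>h\<close>, so the second term vanishes if \<open>v \<in> Y\<^sub>h\<close>, and in general
  \<open>Q\<^sup>-\<^sup>T v\<close> may be replaced by its own projection defect. Both defects are \<open>O(h\<^sup>r)\<close>, because \<open>v\<close> and \<open>g(u)\<close>
  agree up to \<open>O(h\<^sup>r)\<close> with polynomials in \<open>h\<close> and \<open>h \<tau>\<close>, which are regular.\<close>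

section \<open>The matrix exponential\<close>

text \<open>The obstacle is that \<open>projection_accurate\<close> speaks only of
  \<open>regular\<close> families, which come with derivatives in \<open>h\<close>, while
  \<open>u\<close> is known only through its equation and a bound uniform in \<open>h\<close>.
  Polynomials bridge this gap: they are regular themselves, and what separates them from
  \<open>u\<close>, \<open>g(u)\<close> or \<open>v\<close> only has to be small, because a small
  function has a small projection when the kernels are bounded uniformly in \<open>h\<close>. The
  degree restriction persists because each integration in time multiplies by \<open>h\<close>
  whenever it raises the degree in \<tau>. Of the exponent \<open>2 r + 1\<close>, each of the two
  defects contributes \<open>r\<close>, and the last unit is the factor \<open>h\<close> in
  \<open>u' = h v\<close>. When \<open>V\<close> is only differentiable, \<open>g(u)\<close> may be
  discontinuous; integrability then rests on the first conjunct of \<open>ECr_solution\<close> and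
  on the fundamental theorem of calculus.\<close>

lemma bounded_bilinear_matrix_mult:
  "bounded_bilinear ((**) :: real^'n^'m \<Rightarrow> real^'k^'n \<Rightarrow> real^'k^'m)"
proof -
  have "(A + B) ** C = A ** C + B ** C" and "c *\<^sub>R A ** C = c *\<^sub>R (A ** C)"
    and "A ** (C + D) = A ** C + A ** D" and "A ** c *\<^sub>R C = c *\<^sub>R (A ** C)"
    for A B :: "real^'n^'m" and C D :: "real^'k^'n" and c
    by (simp_all add: matrix_matrix_mult_def vec_eq_iff sum_distrib_left mult_ac
        distrib_left distrib_right sum.distrib)
  then have "bilinear ((**) :: real^'n^'m \<Rightarrow> real^'k^'n \<Rightarrow> real^'k^'m)"
    by (auto simp: bilinear_def intro!: linearI)
  then show ?thesis
    by (simp add: bilinear_conv_bounded_bilinear)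
qed

lemma bounded_bilinear_matrix_vector_mult:
  "bounded_bilinear ((*v) :: real^'n^'m \<Rightarrow> real^'n \<Rightarrow> real^'m)"
proof -
  have "(A + B) *v x = A *v x + B *v x" and "c *\<^sub>R A *v x = c *\<^sub>R (A *v x)"
    and "A *v (x + y) = A *v x + A *v y" and "A *v c *\<^sub>R x = c *\<^sub>R (A *v x)"
    for A B :: "real^'n^'m" and x y :: "real^'n" and c
    by (simp_all add: matrix_vector_mult_def vec_eq_iff sum_distrib_left mult_ac
        distrib_left distrib_right sum.distrib)
  then have "bilinear ((*v) :: real^'n^'m \<Rightarrow> real^'n \<Rightarrow> real^'m)"
    by (auto simp: bilinear_def intro!: linearI)
  then show ?thesis
    by (simp add: bilinear_conv_bounded_bilinear)
qed

lemmas bounded_linear_matrix_mult_left =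
  bounded_bilinear.bounded_linear_left[OF bounded_bilinear_matrix_mult]
lemmas bounded_linear_matrix_mult_right =
  bounded_bilinear.bounded_linear_right[OF bounded_bilinear_matrix_mult]
lemmas bounded_linear_matrix_vector_mult_left =
  bounded_bilinear.bounded_linear_left[OF bounded_bilinear_matrix_vector_mult]

text \<open>The iterate inside \<open>mexp\<close>. The power of the type itself would be
  componentwise.\<close>

definition mpow :: "real^'d^'d \<Rightarrow> nat \<Rightarrow> real^'d^'d" where
  "mpow A n = ((\<lambda>B. A ** B) ^^ n) (mat 1)"

lemma mpow_0: "mpow A 0 = mat 1" and mpow_Suc: "mpow A (Suc n) = A ** mpow A n"
  by (simp_all add: mpow_def)

lemma mpow_commute: "mpow A n ** A = A ** mpow A n"
  by (induction n) (simp_all add: mpow_0 mpow_Suc flip: matrix_mul_assoc)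

lemma mpow_scaleR: "mpow (t *\<^sub>R A) n = t ^ n *\<^sub>R mpow A n"
  by (induction n) (simp_all add: mpow_0 mpow_Suc
      bounded_bilinear.scaleR_left[OF bounded_bilinear_matrix_mult]
      bounded_bilinear.scaleR_right[OF bounded_bilinear_matrix_mult])

text \<open>\<open>K\<close> is a bound for the linear map of left multiplication by
  \<open>A\<close>. The factor \<open>norm (mat 1)\<close> stays because the Euclidean norm of the
  identity is not 1 in higher dimension.\<close>

lemma mpow_norm_bound: "\<exists>K. \<forall>n. norm (mpow A n) \<le> norm (mat 1 :: real^'d^'d) * K ^ n"
  for A :: "real^'d^'d"
proof -
  obtain K where K: "K > 0" "\<And>B :: real^'d^'d. norm (A ** B) \<le> norm B * K"
    using bounded_linear.pos_bounded[OF bounded_linear_matrix_mult_right] by blast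
  have "norm (mpow A n) \<le> norm (mat 1 :: real^'d^'d) * K ^ n" for n
  proof (induction n)
    case (Suc n)
    have "norm (mpow A (Suc n)) \<le> norm (mpow A n) * K"
      using K by (simp add: mpow_Suc)
    also have "\<dots> \<le> norm (mat 1 :: real^'d^'d) * K ^ n * K"
      using Suc K(1) by simp
    finally show ?case by (simp add: mult_ac)
  qed (simp add: mpow_0)
  then show ?thesis by blast
qed

lemma summable_mexp: "summable (\<lambda>n. (t ^ n / fact n) *\<^sub>R mpow A n)"
proof -
  obtain K where K: "\<And>n. norm (mpow A n) \<le> norm (mat 1 :: real^'a^'a) * K ^ n"
    using mpow_norm_bound by blast
  have "summable (\<lambda>n. norm (mat 1 :: real^'a^'a) * ((\<bar>t\<bar> * K) ^ n /\<^sub>R fact n))"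
    by (intro summable_mult summable_exp_generic)
  moreover have "norm ((t ^ n / fact n) *\<^sub>R mpow A n)
      \<le> norm (mat 1 :: real^'a^'a) * ((\<bar>t\<bar> * K) ^ n /\<^sub>R fact n)" for n
  proof -
    have "norm ((t ^ n / fact n) *\<^sub>R mpow A n) = (\<bar>t\<bar> ^ n / fact n) * norm (mpow A n)"
      by (simp add: power_abs)
    also have "\<dots> \<le> (\<bar>t\<bar> ^ n / fact n) * (norm (mat 1 :: real^'a^'a) * K ^ n)"
      by (intro mult_left_mono K) simp
    finally show ?thesis by (simp add: field_simps power_mult_distrib)
  qed
  ultimately show ?thesis
    by (rule summable_comparison_test'[where N = 0])
qed

lemma mexp_scaleR_series: "mexp (t *\<^sub>R A) = (\<Sum>n. (t ^ n / fact n) *\<^sub>R mpow A n)"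
  unfolding mexp_def mpow_def[symmetric] by (simp add: mpow_scaleR)

lemma mexp_commute: "mexp (t *\<^sub>R A) ** A = A ** mexp (t *\<^sub>R A)"
  unfolding mexp_scaleR_series
  by (simp add: bounded_linear.suminf[OF bounded_linear_matrix_mult_left summable_mexp]
      bounded_linear.suminf[OF bounded_linear_matrix_mult_right summable_mexp]
      bounded_bilinear.scaleR_left[OF bounded_bilinear_matrix_mult]
      bounded_bilinear.scaleR_right[OF bounded_bilinear_matrix_mult] mpow_commute)

lemma mexp_0: "mexp (0 *\<^sub>R A) = mat 1"
proof -
  have "mexp (0 *\<^sub>R A) = (\<Sum>n\<in>{0}. ((0 :: real) ^ n / fact n) *\<^sub>R mpow A n)"
    unfolding mexp_scaleR_series by (rule suminf_finite) auto
  then show ?thesis by (simp add: mpow_0)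
qed

lemma has_vector_derivative_componentwise:
  fixes f :: "real \<Rightarrow> 'a::real_normed_vector^'n"
  assumes "\<And>i. ((\<lambda>x. f x $ i) has_vector_derivative f' $ i) (at x within S)"
  shows "(f has_vector_derivative f') (at x within S)"
  using assms unfolding has_vector_derivative_def has_derivative_def
  by (auto intro!: vec_tendstoI bounded_linear_scaleR_left)

lemma mexp_has_vector_derivative:
  "((\<lambda>t. mexp (t *\<^sub>R A)) has_vector_derivative A ** mexp (t *\<^sub>R A)) (at t within S)"
proof (intro has_vector_derivative_componentwise)
  fix i j
  define c where "c n = mpow A n $ i $ j / fact n" for n
  have bl: "bounded_linear (\<lambda>X :: real^'a^'a. X $ i $ j)"
    by (intro bounded_linear_compose[OF bounded_linear_vec_nth bounded_linear_vec_nth])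
  have sum: "summable (\<lambda>n. c n * t ^ n)" for t
    using bounded_linear.summable[OF bl summable_mexp[of t A]] by (simp add: c_def mult_ac)
  have ser: "mexp (t *\<^sub>R A) $ i $ j = (\<Sum>n. c n * t ^ n)" for t
    unfolding mexp_scaleR_series bounded_linear.suminf[OF bl summable_mexp]
    by (simp add: c_def mult_ac)
  \<comment> \<open>Each entry is a scalar power series. In
    \<open>diffs c n = (n + 1) c (n + 1)\<close> the factor cancels against the factorial, and
    \<open>mpow_Suc\<close> turns the shifted index into a multiplication by
    \<open>A\<close>.\<close>
  have "(A ** mexp (t *\<^sub>R A)) $ i $ j = (\<Sum>n. diffs c n * t ^ n)"
    unfolding mexp_scaleR_series
      bounded_linear.suminf[OF bounded_linear_compose[OF bl bounded_linear_matrix_mult_right]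
        summable_mexp]
    by (rule arg_cong[of _ _ suminf]) (auto simp: fun_eq_iff diffs_def c_def mpow_Suc
      bounded_bilinear.scaleR_right[OF bounded_bilinear_matrix_mult])
  then show "((\<lambda>t. mexp (t *\<^sub>R A) $ i $ j) has_vector_derivative (A ** mexp (t *\<^sub>R A)) $ i $ j)
      (at t within S)"
    using termdiffs_strong_converges_everywhere[of c t, OF sum]
    by (simp add: ser has_real_derivative_iff_has_vector_derivative[symmetric]
        has_field_derivative_at_within)
qed

lemma mexp_add: "mexp (s *\<^sub>R A) ** mexp (t *\<^sub>R A) = mexp ((s + t) *\<^sub>R A)"
proof -
  \<comment> \<open>The two exponents always add up to \<open>s + t\<close>. The derivative vanishes
    because \<open>A\<close> commutes with its exponential, and the claim compares
    \<open>F s\<close> with \<open>F 0\<close>.\<close>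
  define F where "F x = mexp (x *\<^sub>R A) ** mexp ((s + t - x) *\<^sub>R A)" for x
  have "(F has_vector_derivative 0) (at x)" for x
  proof -
    have "((\<lambda>x. mexp ((s + t - x) *\<^sub>R A)) has_vector_derivative
        (- 1) *\<^sub>R (A ** mexp ((s + t - x) *\<^sub>R A))) (at x)"
      by (rule vector_diff_chain_at[of "\<lambda>x. s + t - x" "-1" x "\<lambda>t. mexp (t *\<^sub>R A)", unfolded o_def])
        (auto intro!: derivative_eq_intros mexp_has_vector_derivative)
    from bounded_bilinear.has_vector_derivative[OF bounded_bilinear_matrix_mult
        mexp_has_vector_derivative this]
    show ?thesis
      unfolding F_def by (rule has_vector_derivative_eq_rhs)
        (simp add: bounded_bilinear.minus_right[OF bounded_bilinear_matrix_mult]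
          matrix_mul_assoc mexp_commute)
  qed
  then obtain c where "\<And>x. F x = c"
    using has_derivative_zero_constant[of UNIV F] by (auto simp: has_vector_derivative_def)
  then have "F s = F 0"
    by simp
  then show ?thesis
    using mexp_0[of A] by (simp add: F_def)
qed

section \<open>The differential equation of the method and the energy balance\<close>

lemma fspan_basis: "i < m \<Longrightarrow> b i \<in> fspan m b"
  unfolding fspan_def
  by (rule CollectI, rule exI[of _ "\<lambda>j. if j = i then 1 else 0"])
    (simp add: if_distrib[of "\<lambda>c. c *\<^sub>R _"] cong: if_cong)

text \<open>Each basis function is a combination of rescaled \<open>\<phi> j\<close>, and
  \<open>h > 0\<close> keeps \<open>\<tau> * h\<close> in the half line on which these are
  continuous.\<close>

lemma orthonormal_basis_continuous:
  assumes "orthonormal_basis r \<phi> h \<psi>" and "\<forall>i<r. Cinf_on {0..} (\<phi> i)" and "h > 0" and "i < r"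
  shows "continuous_on {0..1} (\<psi> i)"
proof -
  have "\<psi> i \<in> fspan r (\<lambda>i. rescale h (\<phi> i))"
    using assms(1) fspan_basis[OF assms(4), of \<psi>] by (simp add: orthonormal_basis_def)
  then obtain c where c: "\<And>\<tau>. \<tau> \<in> {0..1} \<Longrightarrow> \<psi> i \<tau> = (\<Sum>j<r. c j *\<^sub>R rescale h (\<phi> j) \<tau>)"
    by (auto simp: fspan_def)
  have "continuous_on {0..1} (\<lambda>\<tau>. rescale h (\<phi> j) \<tau>)" if "j < r" for j
  proof -
    have "continuous_on {0..} (\<phi> j)"
      using assms(2) that unfolding Cinf_on_def by (metis Ck_on.simps(1))
    then show ?thesis
      unfolding rescale_def
      by (rule continuous_on_compose2) (use assms(3) in \<open>auto intro!: continuous_intros\<close>)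
  qed
  then have "continuous_on {0..1} (\<lambda>\<tau>. \<Sum>j<r. c j *\<^sub>R rescale h (\<phi> j) \<tau>)"
    by (intro continuous_intros) auto
  then show ?thesis
    by (subst continuous_on_cong[OF refl c])
qed

section \<open>The projection and the orthogonality of its defect\<close>

lemma proj_eq:
  assumes "\<forall>i<r. (\<lambda>\<sigma>. \<psi> i \<sigma> *\<^sub>R f \<sigma>) integrable_on {0..1}"
  shows "proj r \<psi> f \<tau> = (\<Sum>i<r. \<psi> i \<tau> *\<^sub>R integral {0..1} (\<lambda>\<sigma>. \<psi> i \<sigma> *\<^sub>R f \<sigma>))"
proof -
  have "proj r \<psi> f \<tau> = integral {0..1} (\<lambda>\<sigma>. \<Sum>i<r. \<psi> i \<tau> *\<^sub>R (\<psi> i \<sigma> *\<^sub>R f \<sigma>))"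
    by (simp add: proj_def kernel_def scaleR_left.sum)
  also have "\<dots> = (\<Sum>i<r. integral {0..1} (\<lambda>\<sigma>. \<psi> i \<tau> *\<^sub>R (\<psi> i \<sigma> *\<^sub>R f \<sigma>)))"
    by (rule integral_sum) (use assms in \<open>auto intro!: integrable_cmul simp del: scaleR_scaleR\<close>)
  finally show ?thesis by (simp del: scaleR_scaleR)
qed

text \<open>By orthonormality, \<open>proj\<close> and \<open>f\<close> have the same pairing with
  the span, the sum of \<open>W i \<bullet> G i\<close>. Only the products of \<open>f\<close> with
  basis functions have to be integrable, so a discontinuous \<open>g(u)\<close> is covered.\<close>

lemma proj_orthogonal:
  fixes f :: "real \<Rightarrow> real^'d"
  assumes "orthonormal_basis r \<phi> h \<psi>" and cont: "\<forall>i<r. continuous_on {0..1} (\<psi> i)"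
    and int: "\<forall>i<r. (\<lambda>\<sigma>. \<psi> i \<sigma> *\<^sub>R f \<sigma>) integrable_on {0..1}"
  shows "((\<lambda>\<tau>. (\<Sum>i<r. \<psi> i \<tau> *\<^sub>R W i) \<bullet> (f \<tau> - proj r \<psi> f \<tau>)) has_integral 0) {0..1}"
proof -
  define G where "G i = integral {0..1} (\<lambda>\<sigma>. \<psi> i \<sigma> *\<^sub>R f \<sigma>)" for i
  have f: "((\<lambda>\<tau>. (\<Sum>i<r. \<psi> i \<tau> *\<^sub>R W i) \<bullet> f \<tau>) has_integral (\<Sum>i<r. W i \<bullet> G i)) {0..1}"
  proof -
    have "((\<lambda>\<tau>. \<Sum>i<r. W i \<bullet> (\<psi> i \<tau> *\<^sub>R f \<tau>)) has_integral (\<Sum>i<r. W i \<bullet> G i)) {0..1}"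
      by (intro has_integral_sum has_integral_linear[OF _ bounded_linear_inner_right, unfolded o_def])
        (use int in \<open>auto simp: G_def intro: integrable_integral\<close>)
    then show ?thesis by (simp add: inner_sum_left)
  qed
  have \<psi>: "((\<lambda>\<tau>. \<psi> i \<tau> * \<psi> j \<tau>) has_integral (if i = j then 1 else 0)) {0..1}" if "i < r" "j < r" for i j
  proof -
    have "(\<lambda>\<tau>. \<psi> i \<tau> * \<psi> j \<tau>) integrable_on {0..1}"
      using cont that by (intro integrable_continuous_interval continuous_intros) auto
    moreover have "integral {0..1} (\<lambda>\<tau>. \<psi> i \<tau> * \<psi> j \<tau>) = (if i = j then 1 else 0)"
      using assms(1) that by (simp add: orthonormal_basis_def L2_inner_def)
    ultimately show ?thesis by (simp only: has_integral_iff)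
  qed
  have "((\<lambda>\<tau>. \<Sum>i<r. \<Sum>j<r. (\<psi> i \<tau> * \<psi> j \<tau>) * (W i \<bullet> G j)) has_integral
      (\<Sum>i<r. \<Sum>j<r. (if i = j then 1 else 0) * (W i \<bullet> G j))) {0..1}"
    by (intro has_integral_sum has_integral_mult_left \<psi>) auto
  moreover have "(\<Sum>i<r. \<Sum>j<r. (if i = j then 1 else 0) * (W i \<bullet> G j)) = (\<Sum>i<r. W i \<bullet> G i)"
    by (intro sum.cong refl) (simp add: if_distrib[of "\<lambda>c. c * _"] cong: if_cong)
  moreover have "(\<Sum>i<r. \<Sum>j<r. (\<psi> i \<tau> * \<psi> j \<tau>) * (W i \<bullet> G j))
      = (\<Sum>i<r. \<psi> i \<tau> *\<^sub>R W i) \<bullet> proj r \<psi> f \<tau>" for \<tau>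
    unfolding proj_eq[OF int] G_def[symmetric] inner_sum_left inner_sum_right
    by (subst sum.swap) (simp add: mult_ac)
  ultimately have "((\<lambda>\<tau>. (\<Sum>i<r. \<psi> i \<tau> *\<^sub>R W i) \<bullet> proj r \<psi> f \<tau>)
      has_integral (\<Sum>i<r. W i \<bullet> G i)) {0..1}"
    by simp
  from has_integral_diff[OF f this] show ?thesis
    by (simp add: inner_diff_right)
qed

section \<open>Variation of constants and the differential equation\<close>

lemma continuous_on_mexp:
  "continuous_on S a \<Longrightarrow> continuous_on S (\<lambda>x. mexp (a x *\<^sub>R A))" for a :: "'a::topological_space \<Rightarrow> real"
  by (rule continuous_on_compose2[of UNIV "\<lambda>t. mexp (t *\<^sub>R A)"])
    (auto simp: continuous_on_eq_continuous_within
      intro: has_vector_derivative_continuous[OF mexp_has_vector_derivative])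

lemmas continuous_on_matrix_vector_mult =
  bounded_bilinear.continuous_on[OF bounded_bilinear_matrix_vector_mult]

text \<open>The substitution \<open>s = \<xi> \<tau>\<close> turns the method into the variation of constants formula.\<close>

lemma ECr_variation_of_constants:
  fixes u :: "real \<Rightarrow> real^'d"
  assumes cont: "\<forall>i<r. continuous_on {0..1} (\<psi> i)" and sol: "ECr_solution r \<psi> h A g y0 u"
    and \<tau>: "\<tau> \<in> {0..1}"
  shows "u \<tau> = mexp ((\<tau> * h) *\<^sub>R A) *v
    (y0 + h *\<^sub>R integral {0..\<tau>} (\<lambda>s. mexp ((- s * h) *\<^sub>R A) *v proj r \<psi> (\<lambda>\<sigma>. g (u \<sigma>)) s))"
proof -
  have int: "\<forall>i<r. (\<lambda>\<sigma>. \<psi> i \<sigma> *\<^sub>R g (u \<sigma>)) integrable_on {0..1}"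
    by (rule sol[unfolded ECr_solution_def, THEN conjunct1])
  define G where "G i = integral {0..1} (\<lambda>\<sigma>. \<psi> i \<sigma> *\<^sub>R g (u \<sigma>))" for i
  have G: "((\<lambda>\<sigma>. \<psi> i \<sigma> *\<^sub>R g (u \<sigma>)) has_integral G i) {0..1}" if "i < r" for i
    using int that by (auto simp: G_def)
  define P where "P = proj r \<psi> (\<lambda>\<sigma>. g (u \<sigma>))"
  have P: "P s = (\<Sum>i<r. \<psi> i s *\<^sub>R G i)" for s
    by (simp add: P_def G_def proj_eq[OF int])
  define f where "f s = mexp ((- s * h) *\<^sub>R A) *v P s" for s
  define J where "J t = integral {0..t} f" for t
  have contf: "continuous_on {0..1} f"
    unfolding f_def P using cont
    by (intro continuous_on_matrix_vector_mult continuous_on_mexp continuous_intros) auto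
  have Jf: "(J has_vector_derivative f t) (at t within {0..1})" if "t \<in> {0..1}" for t
    unfolding J_def using contf that by (rule integral_has_vector_derivative)
  have range: "\<xi> * \<tau> \<in> {0..1}" if "\<xi> \<in> {0..1}" for \<xi>
    using that \<tau> by (auto intro: mult_le_one)
  \<comment> \<open>These are the coefficients of \<open>Abar\<close>, as a function of \<sigma>, in
    the basis. With \<xi> confined to \<open>B i\<close>, the double integral becomes a finite sum
    and no integrals have to be exchanged.\<close>
  define B where "B i = integral {0..1} (\<lambda>\<xi>. \<psi> i (\<xi> * \<tau>) *\<^sub>R mexp (((1 - \<xi>) * \<tau> * h) *\<^sub>R A))" for i
  have cont\<psi>: "continuous_on {0..1} (\<lambda>\<xi>. \<psi> i (\<xi> * \<tau>))" if "i < r" for i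
    by (rule continuous_on_compose2[OF cont[rule_format, OF that]])
      (use range in \<open>auto intro!: continuous_intros\<close>)
  have B: "((\<lambda>\<xi>. \<psi> i (\<xi> * \<tau>) *\<^sub>R mexp (((1 - \<xi>) * \<tau> * h) *\<^sub>R A)) has_integral B i) {0..1}" if "i < r" for i
    unfolding B_def using that
    by (intro integrable_integral integrable_continuous_interval continuous_on_mexp
        continuous_on_scaleR cont\<psi>) (auto intro!: continuous_intros)
  have Abar: "Abar r \<psi> h A \<tau> \<sigma> = (\<Sum>i<r. \<psi> i \<sigma> *\<^sub>R B i)" for \<sigma>
  proof -
    have "((\<lambda>\<xi>. \<Sum>i<r. \<psi> i \<sigma> *\<^sub>R (\<psi> i (\<xi> * \<tau>) *\<^sub>R mexp (((1 - \<xi>) * \<tau> * h) *\<^sub>R A)))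
        has_integral (\<Sum>i<r. \<psi> i \<sigma> *\<^sub>R B i)) {0..1}"
      by (intro has_integral_sum has_integral_cmul B) auto
    then show ?thesis
      unfolding Abar_def kernel_def
      by (intro integral_unique) (simp add: scaleR_left.sum mult.commute)
  qed
  have "((\<lambda>\<sigma>. \<Sum>i<r. B i *v (\<psi> i \<sigma> *\<^sub>R g (u \<sigma>))) has_integral (\<Sum>i<r. B i *v G i)) {0..1}"
    by (intro has_integral_sum has_integral_linear[OF G matrix_vector_mul_bounded_linear, unfolded o_def])
       auto
  moreover have "(\<Sum>i<r. B i *v (\<psi> i \<sigma> *\<^sub>R g (u \<sigma>))) = Abar r \<psi> h A \<tau> \<sigma> *v g (u \<sigma>)" for \<sigma>
    unfolding Abar
    by (simp add: bounded_bilinear.sum_left[OF bounded_bilinear_matrix_vector_mult]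
        bounded_bilinear.scaleR_left[OF bounded_bilinear_matrix_vector_mult]
        bounded_bilinear.scaleR_right[OF bounded_bilinear_matrix_vector_mult])
  ultimately have 1: "integral {0..1} (\<lambda>\<sigma>. Abar r \<psi> h A \<tau> \<sigma> *v g (u \<sigma>)) = (\<Sum>i<r. B i *v G i)"
    by (simp add: integral_unique)
  \<comment> \<open>Differentiating \<open>J (\<xi> * \<tau>)\<close> in \<xi> performs the
    substitution with the factor \<tau> kept on the integrand. Nothing is divided by \<tau>, so
    \<open>\<tau> = 0\<close> is no special case.\<close>
  have "((\<lambda>\<xi>. \<tau> *\<^sub>R f (\<xi> * \<tau>)) has_integral J (1 * \<tau>) - J (0 * \<tau>)) {0..1}"
  proof (rule fundamental_theorem_of_calculus)
    fix \<xi> :: real assume \<xi>: "\<xi> \<in> {0..1}"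
    have "((\<lambda>\<xi>. \<xi> * \<tau>) has_vector_derivative \<tau>) (at \<xi> within {0..1})"
      by (auto intro!: derivative_eq_intros)
    moreover have "(J has_vector_derivative f (\<xi> * \<tau>)) (at (\<xi> * \<tau>) within (\<lambda>\<xi>. \<xi> * \<tau>) ` {0..1})"
      by (rule has_vector_derivative_within_subset[OF Jf[OF range[OF \<xi>]]]) (use range in auto)
    ultimately show "((\<lambda>\<xi>. J (\<xi> * \<tau>)) has_vector_derivative \<tau> *\<^sub>R f (\<xi> * \<tau>)) (at \<xi> within {0..1})"
      using vector_diff_chain_within[of "\<lambda>\<xi>. \<xi> * \<tau>" \<tau> \<xi> "{0..1}" J] by (simp add: o_def)
  qed simp
  then have "((\<lambda>\<xi>. \<tau> *\<^sub>R f (\<xi> * \<tau>)) has_integral J \<tau>) {0..1}"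
    by (simp add: J_def)
  from has_integral_linear[OF this matrix_vector_mul_bounded_linear[of "mexp ((\<tau> * h) *\<^sub>R A)"]]
  have "((\<lambda>\<xi>. mexp ((\<tau> * h) *\<^sub>R A) *v (\<tau> *\<^sub>R f (\<xi> * \<tau>))) has_integral
      mexp ((\<tau> * h) *\<^sub>R A) *v J \<tau>) {0..1}"
    by (simp add: o_def)
  moreover have "mexp ((\<tau> * h) *\<^sub>R A) *v (\<tau> *\<^sub>R f (\<xi> * \<tau>))
      = \<tau> *\<^sub>R (\<Sum>i<r. (\<psi> i (\<xi> * \<tau>) *\<^sub>R mexp (((1 - \<xi>) * \<tau> * h) *\<^sub>R A)) *v G i)" for \<xi>
  proof -
    have "mexp ((\<tau> * h) *\<^sub>R A) *v f (\<xi> * \<tau>) = mexp (((1 - \<xi>) * \<tau> * h) *\<^sub>R A) *v P (\<xi> * \<tau>)"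
      using mexp_add[of "\<tau> * h" A "- (\<xi> * \<tau>) * h"]
      by (simp add: f_def matrix_vector_mul_assoc left_diff_distrib)
    then show ?thesis
      by (simp add: P bounded_bilinear.sum_right[OF bounded_bilinear_matrix_vector_mult]
        bounded_bilinear.scaleR_left[OF bounded_bilinear_matrix_vector_mult]
        bounded_bilinear.scaleR_right[OF bounded_bilinear_matrix_vector_mult])
  qed
  moreover have "((\<lambda>\<xi>. \<tau> *\<^sub>R (\<Sum>i<r. (\<psi> i (\<xi> * \<tau>) *\<^sub>R mexp (((1 - \<xi>) * \<tau> * h) *\<^sub>R A)) *v G i))
      has_integral \<tau> *\<^sub>R (\<Sum>i<r. B i *v G i)) {0..1}"
    by (intro has_integral_cmul has_integral_sum
        has_integral_linear[OF B bounded_linear_matrix_vector_mult_left, unfolded o_def]) auto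
  ultimately have "\<tau> *\<^sub>R (\<Sum>i<r. B i *v G i) = mexp ((\<tau> * h) *\<^sub>R A) *v J \<tau>"
    by (simp add: has_integral_unique)
  then have "h *\<^sub>R (\<tau> *\<^sub>R (\<Sum>i<r. B i *v G i)) = mexp ((\<tau> * h) *\<^sub>R A) *v (h *\<^sub>R J \<tau>)"
    by (simp only: bounded_bilinear.scaleR_right[OF bounded_bilinear_matrix_vector_mult])
  then have "(\<tau> * h) *\<^sub>R (\<Sum>i<r. B i *v G i) = mexp ((\<tau> * h) *\<^sub>R A) *v (h *\<^sub>R J \<tau>)"
    by (simp only: scaleR_scaleR mult.commute)
  moreover have "u \<tau> = mexp ((\<tau> * h) *\<^sub>R A) *v y0 + (\<tau> * h) *\<^sub>R (\<Sum>i<r. B i *v G i)"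
    unfolding 1[symmetric]
    by (rule sol[unfolded ECr_solution_def, THEN conjunct2, THEN bspec, OF \<tau>])
  ultimately show ?thesis
    by (simp add: matrix_vector_right_distrib J_def f_def[abs_def] P_def)
qed

lemma ECr_initial:
  assumes "ECr_solution r \<psi> h A g y0 u"
  shows "u 0 = y0"
proof -
  have "u 0 = mexp ((0 * h) *\<^sub>R A) *v y0
      + (0 * h) *\<^sub>R integral {0..1} (\<lambda>\<sigma>. Abar r \<psi> h A 0 \<sigma> *v g (u \<sigma>))"
    by (rule assms[unfolded ECr_solution_def, THEN conjunct2, THEN bspec]) simp
  then show ?thesis
    using mexp_0[of A] by simp
qed

text \<open>The projection is a finite combination of basis functions, so it is continuous even
  where \<open>f\<close> is not.\<close>

lemma continuous_on_proj:
  assumes "\<forall>i<r. continuous_on S (\<psi> i)"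
    and "\<forall>i<r. (\<lambda>\<sigma>. \<psi> i \<sigma> *\<^sub>R f \<sigma>) integrable_on {0..1}"
  shows "continuous_on S (proj r \<psi> f)"
  unfolding proj_eq[OF assms(2), abs_def] using assms(1) by (intro continuous_intros) auto

text \<open>Product rule for \<open>E t *v z t\<close>: the derivative of \<open>E\<close> yields
  \<open>A u\<close>, and in that of \<open>z\<close> the exponentials cancel and leave the
  projection. The integral in \<open>z\<close> can be differentiated because its integrand contains
  \<open>g(u)\<close> only through the continuous projection.\<close>

lemma ECr_ode:
  fixes u :: "real \<Rightarrow> real^'d"
  assumes cont: "\<forall>i<r. continuous_on {0..1} (\<psi> i)" and sol: "ECr_solution r \<psi> h A g y0 u"
    and \<tau>: "\<tau> \<in> {0..1}"
  shows "(u has_vector_derivative h *\<^sub>R (A *v u \<tau> + proj r \<psi> (\<lambda>\<sigma>. g (u \<sigma>)) \<tau>)) (at \<tau> within {0..1})"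
proof -
  have int: "\<forall>i<r. (\<lambda>\<sigma>. \<psi> i \<sigma> *\<^sub>R g (u \<sigma>)) integrable_on {0..1}"
    by (rule sol[unfolded ECr_solution_def, THEN conjunct1])
  define P where "P = proj r \<psi> (\<lambda>\<sigma>. g (u \<sigma>))"
  define E where "E t = mexp ((t * h) *\<^sub>R A)" for t
  define f where "f s = mexp ((- s * h) *\<^sub>R A) *v P s" for s
  define z where "z t = y0 + h *\<^sub>R integral {0..t} f" for t
  have u: "u t = E t *v z t" if "t \<in> {0..1}" for t
    using ECr_variation_of_constants[OF cont sol that] by (simp add: E_def z_def f_def[abs_def] P_def)
  have "continuous_on {0..1} f"
    unfolding f_def P_def
    by (intro continuous_on_matrix_vector_mult continuous_on_mexp continuous_on_proj cont int
        continuous_intros)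
  from integral_has_vector_derivative[OF this \<tau>]
  have z: "(z has_vector_derivative h *\<^sub>R f \<tau>) (at \<tau> within {0..1})"
    unfolding z_def by (auto intro!: derivative_eq_intros)
  have E: "(E has_vector_derivative h *\<^sub>R (A ** E \<tau>)) (at \<tau> within {0..1})"
  proof -
    have "((\<lambda>t. t * h) has_vector_derivative h) (at \<tau> within {0..1})"
      by (auto intro!: derivative_eq_intros)
    from vector_diff_chain_within[OF this mexp_has_vector_derivative] show ?thesis
      by (simp add: E_def[abs_def] o_def)
  qed
  have "E \<tau> ** mexp ((- \<tau> * h) *\<^sub>R A) = mat 1"
    using mexp_add[of "\<tau> * h" A "- \<tau> * h"] mexp_0[of A] by (simp add: E_def)
  then have Ef: "E \<tau> *v f \<tau> = P \<tau>"
    by (simp add: f_def matrix_vector_mul_assoc)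
  have "((\<lambda>t. E t *v z t) has_vector_derivative h *\<^sub>R (A *v u \<tau> + P \<tau>)) (at \<tau> within {0..1})"
    using bounded_bilinear.has_vector_derivative[OF bounded_bilinear_matrix_vector_mult E z] u[OF \<tau>]
    by (simp add: bounded_bilinear.scaleR_left[OF bounded_bilinear_matrix_vector_mult]
        bounded_bilinear.scaleR_right[OF bounded_bilinear_matrix_vector_mult] Ef
        matrix_vector_mul_assoc scaleR_add_right add.commute)
  then show ?thesis
    unfolding P_def
    by (rule has_vector_derivative_transform[OF \<tau>, where f = "\<lambda>t. E t *v z t", rotated]) (rule u)
qed

lemma ECr_continuous:
  assumes "\<forall>i<r. continuous_on {0..1} (\<psi> i)" and "ECr_solution r \<psi> h A g y0 u"
  shows "continuous_on {0..1} u"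
  by (rule continuous_on_vector_derivative) (rule ECr_ode[OF assms])

section \<open>The energy balance over one step\<close>

lemma energy_has_derivative:
  fixes M :: "real^'d^'d"
  assumes "transpose M = M" and "V differentiable (at y)"
  shows "(energy M V has_derivative (\<lambda>x. x \<bullet> (M *v y + grad V y))) (at y)"
proof -
  \<comment> \<open>\<open>grad\<close> is a definite description, so the equation
    \<open>grad_energy\<close> alone gives no derivative. Differentiability has to be established
    before \<open>GDERIV_grad\<close> applies.\<close>
  have "(\<lambda>y. y \<bullet> (M *v y)) differentiable (at y)"
    using bounded_bilinear.FDERIV[OF bounded_bilinear_inner has_derivative_ident
        bounded_linear_imp_has_derivative[OF matrix_vector_mul_bounded_linear]]
    by (auto simp: differentiable_def)
  then have "energy M V differentiable (at y)"
    unfolding energy_def[abs_def] using assms(2)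
    by (intro differentiable_add differentiable_mult differentiable_const)
  from GDERIV_grad[OF this] show ?thesis
    by (simp add: gderiv_def grad_energy[OF assms])
qed

text \<open>Here \<open>M y + G\<close> is the inverse of \<open>Q\<close> applied to
  \<open>v + (Q G - p)\<close>, and \<open>z\<close> moves this inverse onto \<open>v\<close>. With
  \<open>x\<close> the inverse image of \<open>v\<close> under \<open>Q\<close>, the product
  \<open>z \<bullet> v\<close> is \<open>x \<bullet> (Q *v x)\<close>, where semidefiniteness
  enters.\<close>

lemma dissipation:
  fixes Q M :: "real^'d^'d" and v y G :: "real^'d"
  assumes "invertible Q" and "\<forall>x. x \<bullet> (Q *v x) \<le> 0" and v: "v = (Q ** M) *v y + p"
  defines "z \<equiv> transpose (matrix_inv Q) *v v"
  shows "v \<bullet> (M *v y + G) = z \<bullet> v + z \<bullet> (Q *v G - p)" and "z \<bullet> v \<le> 0"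
proof -
  have Q: "matrix_inv Q ** Q = mat 1" "Q ** matrix_inv Q = mat 1"
    using someI_ex[OF assms(1)[unfolded invertible_def]] unfolding matrix_inv_def by blast+
  have z: "z \<bullet> x = v \<bullet> (matrix_inv Q *v x)" for x
    unfolding z_def transpose_matrix_vector by (rule dot_lmul_matrix)
  have "M *v y + G = matrix_inv Q *v (Q *v (M *v y + G))"
    by (simp only: matrix_vector_mul_assoc[of "matrix_inv Q"] Q matrix_vector_mul_lid)
  also have "Q *v (M *v y + G) = v + (Q *v G - p)"
    by (simp add: v matrix_vector_right_distrib matrix_vector_mul_assoc)
  finally show "v \<bullet> (M *v y + G) = z \<bullet> v + z \<bullet> (Q *v G - p)"
    by (simp only: z matrix_vector_right_distrib inner_add_right)
  have "z \<bullet> v = (matrix_inv Q *v v) \<bullet> (Q *v (matrix_inv Q *v v))"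
    unfolding z matrix_vector_mul_assoc Q matrix_vector_mul_lid by (rule inner_commute)
  then show "z \<bullet> v \<le> 0"
    using assms(2) by simp
qed

text \<open>The sum over \<open>W\<close> does not contribute to the integral of \<open>d\<close>, because \<open>g(u) - p\<close> is orthogonal to the
  span of the basis. It is there to be chosen close to \<open>Q\<^sup>-\<^sup>T v\<close>.\<close>

lemma energy_defect:
  fixes Q M :: "real^'d^'d" and V :: "real^'d \<Rightarrow> real" and u :: "real \<Rightarrow> real^'d" and W :: "nat \<Rightarrow> real^'d"
  defines "g \<equiv> (\<lambda>y. Q *v grad V y)"
  assumes "invertible Q" and "transpose M = M" and V: "\<forall>y. V differentiable (at y)"
    and "\<forall>x. x \<bullet> (Q *v x) \<le> 0" and h: "h > 0"
    and ortho: "orthonormal_basis r \<phi> h \<psi>" and cont: "\<forall>i<r. continuous_on {0..1} (\<psi> i)"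
    and sol: "ECr_solution r \<psi> h (Q ** M) g y0 u"
  defines "p \<equiv> proj r \<psi> (\<lambda>\<sigma>. g (u \<sigma>))"
  defines "v \<equiv> (\<lambda>\<tau>. (Q ** M) *v u \<tau> + p \<tau>)"
  defines "d \<equiv> (\<lambda>\<tau>. (transpose (matrix_inv Q) *v v \<tau> - (\<Sum>i<r. \<psi> i \<tau> *\<^sub>R W i)) \<bullet> (g (u \<tau>) - p \<tau>))"
  shows "d integrable_on {0..1}" and "energy M V (u 1) \<le> energy M V y0 + h * integral {0..1} d"
proof -
  define z where "z \<tau> = transpose (matrix_inv Q) *v v \<tau>" for \<tau>
  have int: "\<forall>i<r. (\<lambda>\<sigma>. \<psi> i \<sigma> *\<^sub>R g (u \<sigma>)) integrable_on {0..1}"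
    by (rule sol[unfolded ECr_solution_def, THEN conjunct1])
  have ode: "(u has_vector_derivative h *\<^sub>R v \<tau>) (at \<tau> within {0..1})" if "\<tau> \<in> {0..1}" for \<tau>
    unfolding v_def p_def by (rule ECr_ode[OF cont sol that])
  have contv: "continuous_on {0..1} v"
    unfolding v_def p_def
    by (intro continuous_on_add continuous_on_proj[OF cont int] ECr_continuous[OF cont sol]
        bounded_linear.continuous_on[OF matrix_vector_mul_bounded_linear])
  have diss: "v \<tau> \<bullet> (M *v u \<tau> + grad V (u \<tau>)) = z \<tau> \<bullet> v \<tau> + z \<tau> \<bullet> (g (u \<tau>) - p \<tau>)"
    "z \<tau> \<bullet> v \<tau> \<le> 0" for \<tau>
    unfolding z_def g_def
    by (rule dissipation[OF assms(2,5), where y = "u \<tau>" and p = "p \<tau>"], simp only: v_def)+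
  have zv: "(\<lambda>\<tau>. z \<tau> \<bullet> v \<tau>) integrable_on {0..1}"
    unfolding z_def by (intro integrable_continuous_interval continuous_on_inner contv
        bounded_linear.continuous_on[OF matrix_vector_mul_bounded_linear])
  \<comment> \<open>The fundamental theorem of calculus also delivers integrability of this rate,
    although \<open>grad V\<close> along \<open>u\<close> need not be continuous. \<open>d\<close>
    inherits it, since it arises by subtracting integrable terms.\<close>
  have "((\<lambda>\<tau>. (h *\<^sub>R v \<tau>) \<bullet> (M *v u \<tau> + grad V (u \<tau>))) has_integral
      energy M V (u 1) - energy M V (u 0)) {0..1}"
  proof (rule fundamental_theorem_of_calculus)
    fix \<tau> :: real assume \<tau>: "\<tau> \<in> {0..1}"
    show "((\<lambda>\<tau>. energy M V (u \<tau>)) has_vector_derivative (h *\<^sub>R v \<tau>) \<bullet> (M *v u \<tau> + grad V (u \<tau>)))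
        (at \<tau> within {0..1})"
      using has_derivative_compose[OF ode[OF \<tau>, unfolded has_vector_derivative_def]
          energy_has_derivative[OF assms(3) V[rule_format]]]
      by (simp add: has_vector_derivative_def mult.assoc)
  qed simp
  then have "((\<lambda>\<tau>. h * (z \<tau> \<bullet> v \<tau> + z \<tau> \<bullet> (g (u \<tau>) - p \<tau>))) has_integral
      energy M V (u 1) - energy M V y0) {0..1}"
    by (simp only: diss inner_scaleR_left ECr_initial[OF sol])
  from has_integral_mult_right[OF this, of "1 / h"] h
  have "((\<lambda>\<tau>. z \<tau> \<bullet> v \<tau> + z \<tau> \<bullet> (g (u \<tau>) - p \<tau>)) has_integral
      (energy M V (u 1) - energy M V y0) / h) {0..1}"
    by simp
  from has_integral_diff[OF has_integral_diff[OF this integrable_integral[OF zv]]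
      proj_orthogonal[OF ortho cont int, folded p_def, of W]]
  have d: "(d has_integral (energy M V (u 1) - energy M V y0) / h - integral {0..1} (\<lambda>\<tau>. z \<tau> \<bullet> v \<tau>)) {0..1}"
    by (simp add: d_def z_def inner_diff_left)
  then show "d integrable_on {0..1}" by blast
  have "integral {0..1} (\<lambda>\<tau>. z \<tau> \<bullet> v \<tau>) \<le> 0"
    using integral_le[OF zv integrable_0] diss(2) by simp
  with integral_unique[OF d] have "(energy M V (u 1) - energy M V y0) / h \<le> integral {0..1} d"
    by simp
  with h show "energy M V (u 1) \<le> energy M V y0 + h * integral {0..1} d"
    by (simp add: field_simps)
qed

text \<open>Equality of the scalar spans gives a matrix of coefficients \<open>c\<close> from \<psi>
  to the rescaled \<phi>, and this matrix also transforms the vector coefficients.\<close>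

lemma Yspace_orthonormal_representation:
  assumes ortho: "orthonormal_basis r \<phi> h \<psi>" and "w \<in> Yspace r \<phi> h"
  obtains W where "\<And>\<tau>. \<tau> \<in> {0..1} \<Longrightarrow> w \<tau> = (\<Sum>i<r. \<psi> i \<tau> *\<^sub>R W i)"
proof -
  obtain U where U: "\<And>\<tau>. \<tau> \<in> {0..1} \<Longrightarrow> w \<tau> = (\<Sum>i<r. rescale h (\<phi> i) \<tau> *\<^sub>R U i)"
    using assms(2) by (auto simp: Yspace_def)
  have "rescale h (\<phi> i) \<in> fspan r \<psi>" if "i < r" for i
    using ortho fspan_basis[OF that, of "\<lambda>i. rescale h (\<phi> i)"] by (simp add: orthonormal_basis_def)
  then have "\<forall>i. \<exists>c. i < r \<longrightarrow> (\<forall>\<tau>\<in>{0..1}. rescale h (\<phi> i) \<tau> = (\<Sum>j<r. c j * \<psi> j \<tau>))"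
    by (auto simp: fspan_def)
  then obtain c where c: "\<And>i \<tau>. i < r \<Longrightarrow> \<tau> \<in> {0..1} \<Longrightarrow> rescale h (\<phi> i) \<tau> = (\<Sum>j<r. c i j * \<psi> j \<tau>)"
    by metis
  have "w \<tau> = (\<Sum>j<r. \<psi> j \<tau> *\<^sub>R (\<Sum>i<r. c i j *\<^sub>R U i))" if "\<tau> \<in> {0..1}" for \<tau>
  proof -
    have "w \<tau> = (\<Sum>i<r. \<Sum>j<r. \<psi> j \<tau> *\<^sub>R (c i j *\<^sub>R U i))"
      using that by (simp add: U c scaleR_left.sum mult.commute)
    also have "\<dots> = (\<Sum>j<r. \<Sum>i<r. \<psi> j \<tau> *\<^sub>R (c i j *\<^sub>R U i))"
      by (rule sum.swap)
    finally show ?thesis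
      by (simp only: scaleR_sum_right)
  qed
  then show ?thesis by (rule that)
qed

text \<open>Membership in \<open>X\<close> places the time derivative of \<open>u\<close> in
  \<open>Yspace\<close>, and uniqueness of derivatives together with \<open>h > 0\<close> identifies
  it with \<open>v\<close>. A constant matrix acts on the coefficients of \<open>v\<close>, so
  \<open>W\<close> in \<open>energy_defect\<close> can be chosen to make the integrand
  vanish.\<close>

lemma energy_nonincreasing_in_Xspace:
  fixes Q M :: "real^'d^'d" and V :: "real^'d \<Rightarrow> real" and u :: "real \<Rightarrow> real^'d"
  defines "g \<equiv> (\<lambda>y. Q *v grad V y)"
  assumes "invertible Q" and "transpose M = M" and "\<forall>y. V differentiable (at y)"
    and "\<forall>x. x \<bullet> (Q *v x) \<le> 0" and "h > 0"
    and ortho: "orthonormal_basis r \<phi> h \<psi>" and cont: "\<forall>i<r. continuous_on {0..1} (\<psi> i)"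
    and sol: "ECr_solution r \<psi> h (Q ** M) g y0 u"
    and X: "is_Xspace r \<phi> h X" "u \<in> X"
  shows "energy M V (u 1) \<le> energy M V y0"
proof -
  define v where "v \<tau> = (Q ** M) *v u \<tau> + proj r \<psi> (\<lambda>\<sigma>. g (u \<sigma>)) \<tau>" for \<tau>
  obtain w where w: "w \<in> Yspace r \<phi> h"
    and "\<And>\<tau>. \<tau> \<in> {0..1} \<Longrightarrow> (u has_vector_derivative h *\<^sub>R w \<tau>) (at \<tau> within {0..1})"
    using X by (auto simp: is_Xspace_def)
  then have "h *\<^sub>R v \<tau> = h *\<^sub>R w \<tau>" if "\<tau> \<in> {0..1}" for \<tau>
    using that ECr_ode[OF cont sol that, folded v_def]
    by (intro vector_derivative_unique_within_closed_interval[of 0 1 \<tau> u]) auto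
  with \<open>h > 0\<close> have vw: "v \<tau> = w \<tau>" if "\<tau> \<in> {0..1}" for \<tau>
    using that by simp
  obtain W where W: "\<And>\<tau>. \<tau> \<in> {0..1} \<Longrightarrow> v \<tau> = (\<Sum>i<r. \<psi> i \<tau> *\<^sub>R W i)"
    using Yspace_orthonormal_representation[OF ortho w] vw by metis
  define B where "B = transpose (matrix_inv Q)"
  have zero: "B *v v \<tau> - (\<Sum>i<r. \<psi> i \<tau> *\<^sub>R (B *v W i)) = 0" if "\<tau> \<in> {0..1}" for \<tau>
    using that by (simp add: W bounded_bilinear.sum_right[OF bounded_bilinear_matrix_vector_mult]
        bounded_bilinear.scaleR_right[OF bounded_bilinear_matrix_vector_mult])
  have "((\<lambda>\<tau>. (B *v v \<tau> - (\<Sum>i<r. \<psi> i \<tau> *\<^sub>R (B *v W i))) \<bullet>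
      (g (u \<tau>) - proj r \<psi> (\<lambda>\<sigma>. g (u \<sigma>)) \<tau>)) has_integral 0) {0..1}"
    by (rule has_integral_is_0) (simp only: zero inner_zero_left)
  note integral_unique[OF this, unfolded v_def g_def]
  with energy_defect(2)[OF assms(2-6) ortho cont sol[unfolded g_def], of "\<lambda>i. B *v W i", folded B_def]
  show ?thesis by (simp only: mult_zero_right add_0_right)
qed

section \<open>Uniform order estimates\<close>

lemma unif_bigoI:
  assumes "\<forall>\<^sub>F h in at_right 0. h > 0 \<longrightarrow> h < 1 \<longrightarrow> (\<forall>\<tau>\<in>{0..1}. norm (f h \<tau>) \<le> C * h ^ n)"
  shows "unif_bigo n f"
  unfolding unif_bigo_def
proof
  show "\<forall>\<^sub>F h in at_right 0. \<forall>\<tau>\<in>{0..1}. norm (f h \<tau>) \<le> C * h ^ n"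
    using assms eventually_at_right_real[OF zero_less_one]
    by eventually_elim auto
qed

text \<open>A nonnegative constant and \<open>0 < h < 1\<close> are free of charge near 0. Comparing
  powers of \<open>h\<close> and multiplying bounds rely on them.\<close>

lemma unif_bigoE:
  assumes "unif_bigo n f"
  obtains C where "C \<ge> 0"
    and "\<forall>\<^sub>F h in at_right 0. 0 < h \<and> h < 1 \<and> (\<forall>\<tau>\<in>{0..1}. norm (f h \<tau>) \<le> C * h ^ n)"
proof -
  obtain C where C: "\<forall>\<^sub>F h in at_right 0. \<forall>\<tau>\<in>{0..1}. norm (f h \<tau>) \<le> C * h ^ n"
    using assms by (auto simp: unif_bigo_def)
  have "\<forall>\<^sub>F h in at_right 0. 0 < h \<and> h < 1 \<and> (\<forall>\<tau>\<in>{0..1}. norm (f h \<tau>) \<le> \<bar>C\<bar> * h ^ n)"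
    using C eventually_at_right_real[OF zero_less_one]
  proof eventually_elim
    case (elim h)
    then have "C * h ^ n \<le> \<bar>C\<bar> * h ^ n"
      by (intro mult_right_mono) auto
    with elim show ?case by (auto intro: order_trans)
  qed
  then show ?thesis by (rule that[rotated]) simp
qed

lemma unif_bigo_weaken:
  assumes "unif_bigo n f" and "m \<le> n"
  shows "unif_bigo m f"
proof -
  obtain C where "C \<ge> 0"
    and C: "\<forall>\<^sub>F h in at_right 0. 0 < h \<and> h < 1 \<and> (\<forall>\<tau>\<in>{0..1}. norm (f h \<tau>) \<le> C * h ^ n)"
    using assms(1) by (rule unif_bigoE)
  show ?thesis
  proof (rule unif_bigoI)
    show "\<forall>\<^sub>F h in at_right 0. h > 0 \<longrightarrow> h < 1 \<longrightarrow> (\<forall>\<tau>\<in>{0..1}. norm (f h \<tau>) \<le> C * h ^ m)"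
      using C
    proof eventually_elim
      case (elim h)
      then have "C * h ^ n \<le> C * h ^ m"
        using \<open>C \<ge> 0\<close> assms(2) by (intro mult_left_mono power_decreasing) auto
      with elim show ?case by force
    qed
  qed
qed

lemma unif_bigo_bound:
  assumes "unif_bigo n f"
    and "\<forall>\<^sub>F h in at_right 0. \<forall>\<tau>\<in>{0..1}. norm (g h \<tau>) \<le> K * norm (f h \<tau>)" and "K \<ge> 0"
  shows "unif_bigo n g"
proof -
  obtain C where C: "\<forall>\<^sub>F h in at_right 0. 0 < h \<and> h < 1 \<and> (\<forall>\<tau>\<in>{0..1}. norm (f h \<tau>) \<le> C * h ^ n)"
    using assms(1) by (rule unif_bigoE)
  have "\<forall>\<^sub>F h in at_right 0. h > 0 \<longrightarrow> h < 1 \<longrightarrow> (\<forall>\<tau>\<in>{0..1}. norm (g h \<tau>) \<le> (K * C) * h ^ n)"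
    using C assms(2)
  proof eventually_elim
    case (elim h)
    have "norm (g h \<tau>) \<le> (K * C) * h ^ n" if "\<tau> \<in> {0..1}" for \<tau>
    proof -
      have "norm (g h \<tau>) \<le> K * norm (f h \<tau>)"
        using elim that by blast
      also have "\<dots> \<le> K * (C * h ^ n)"
        using elim that \<open>K \<ge> 0\<close> by (intro mult_left_mono) auto
      finally show ?thesis by (simp add: mult.assoc)
    qed
    then show ?case by blast
  qed
  then show ?thesis by (rule unif_bigoI)
qed

lemma unif_bigo_cong:
  assumes "unif_bigo n f" and "\<forall>\<^sub>F h in at_right 0. \<forall>\<tau>\<in>{0..1}. g h \<tau> = f h \<tau>"
  shows "unif_bigo n g"
  by (rule unif_bigo_bound[OF assms(1), where K = 1]) (use assms(2) in \<open>auto elim: eventually_mono\<close>)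

lemma unif_bigo_zero: "unif_bigo n (\<lambda>h \<tau>. 0)"
  by (rule unif_bigoI[of _ 0]) simp

lemma unif_bigo_add:
  assumes "unif_bigo n f" and "unif_bigo n g"
  shows "unif_bigo n (\<lambda>h \<tau>. f h \<tau> + g h \<tau>)"
proof -
  obtain C where C: "\<forall>\<^sub>F h in at_right 0. 0 < h \<and> h < 1 \<and> (\<forall>\<tau>\<in>{0..1}. norm (f h \<tau>) \<le> C * h ^ n)"
    using assms(1) by (rule unif_bigoE)
  obtain D where D: "\<forall>\<^sub>F h in at_right 0. 0 < h \<and> h < 1 \<and> (\<forall>\<tau>\<in>{0..1}. norm (g h \<tau>) \<le> D * h ^ n)"
    using assms(2) by (rule unif_bigoE)
  have "\<forall>\<^sub>F h in at_right 0. h > 0 \<longrightarrow> h < 1 \<longrightarrow> (\<forall>\<tau>\<in>{0..1}. norm (f h \<tau> + g h \<tau>) \<le> (C + D) * h ^ n)"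
    using C D
  proof eventually_elim
    case (elim h)
    then show ?case
      unfolding distrib_right by (intro impI ballI norm_triangle_mono) auto
  qed
  then show ?thesis by (rule unif_bigoI)
qed

lemma unif_bigo_minus: "unif_bigo n f \<Longrightarrow> unif_bigo n (\<lambda>h \<tau>. - f h \<tau>)"
  by (rule unif_bigo_bound[where K = 1 and f = f]) auto

lemma unif_bigo_diff:
  assumes "unif_bigo n f" and "unif_bigo n g"
  shows "unif_bigo n (\<lambda>h \<tau>. f h \<tau> - g h \<tau>)"
  using unif_bigo_add[OF assms(1) unif_bigo_minus[OF assms(2)]] by simp

lemma unif_bigo_sum:
  assumes "\<And>i. i \<in> I \<Longrightarrow> unif_bigo n (f i)"
  shows "unif_bigo n (\<lambda>h \<tau>. \<Sum>i\<in>I. f i h \<tau>)"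
  using assms
  by (induction I rule: infinite_finite_induct) (auto intro: unif_bigo_zero unif_bigo_add)

lemma unif_bigo_mult_bounded:
  fixes f g :: "real \<Rightarrow> real \<Rightarrow> real"
  assumes "unif_bigo n f" and "\<And>h \<tau>. h \<in> {0..1} \<Longrightarrow> \<tau> \<in> {0..1} \<Longrightarrow> \<bar>g h \<tau>\<bar> \<le> B"
  shows "unif_bigo n (\<lambda>h \<tau>. f h \<tau> * g h \<tau>)"
proof (rule unif_bigo_bound[OF assms(1), where K = B])
  show "B \<ge> 0"
    using assms(2)[of 0 0] by simp
  show "\<forall>\<^sub>F h in at_right 0. \<forall>\<tau>\<in>{0..1}. norm (f h \<tau> * g h \<tau>) \<le> B * norm (f h \<tau>)"
    using eventually_at_right_real[OF zero_less_one]
  proof eventually_elim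
    case (elim h)
    then show ?case
      using assms(2)[of h] by (auto simp: abs_mult mult.commute[of B] intro!: mult_left_mono)
  qed
qed

lemma unif_bigo_vec_iff:
  fixes f :: "real \<Rightarrow> real \<Rightarrow> real^'d"
  shows "unif_bigo n f \<longleftrightarrow> (\<forall>i. unif_bigo n (\<lambda>h \<tau>. f h \<tau> $ i))"
proof
  assume "unif_bigo n f"
  then show "\<forall>i. unif_bigo n (\<lambda>h \<tau>. f h \<tau> $ i)"
    by (auto intro!: unif_bigo_bound[where f = f and K = 1] always_eventually component_le_norm_cart)
next
  assume "\<forall>i. unif_bigo n (\<lambda>h \<tau>. f h \<tau> $ i)"
  then have "unif_bigo n (\<lambda>h \<tau>. norm (f h \<tau> $ i))" for i
    by (rule_tac unif_bigo_bound[where f = "\<lambda>h \<tau>. f h \<tau> $ i" and K = 1]) auto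
  then have "unif_bigo n (\<lambda>h \<tau>. \<Sum>i\<in>UNIV. norm (f h \<tau> $ i))"
    by (rule unif_bigo_sum)
  then show "unif_bigo n f"
    by (rule unif_bigo_bound[where K = 1])
      (use norm_le_l1_cart in \<open>auto intro!: always_eventually order_trans[OF _ abs_ge_self]\<close>)
qed

lemma unif_bigo_matrix_vector_mult:
  fixes f :: "real \<Rightarrow> real \<Rightarrow> real^'d"
  assumes "unif_bigo n f"
  shows "unif_bigo n (\<lambda>h \<tau>. A *v f h \<tau>)"
proof -
  obtain K where "K > 0" "\<And>x. norm (A *v x) \<le> norm x * K"
    using bounded_linear.pos_bounded[OF matrix_vector_mul_bounded_linear] by blast
  then show ?thesis
    by (intro unif_bigo_bound[OF assms, where K = K]) (auto simp: mult.commute)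
qed

text \<open>Mean value theorem in \<open>h\<close> at fixed \<tau>: the length \<open>h\<close> of
  the interval gives the additional order.\<close>

lemma unif_bigo_integrate_step:
  fixes f :: "real \<Rightarrow> real \<Rightarrow> real"
  assumes f': "unif_bigo k f'"
    and "\<And>h \<tau>. \<tau> \<in> {0..1} \<Longrightarrow> ((\<lambda>s. f s \<tau>) has_real_derivative f' h \<tau>) (at h)"
    and "\<And>\<tau>. \<tau> \<in> {0..1} \<Longrightarrow> f 0 \<tau> = 0"
  shows "unif_bigo (Suc k) f"
proof -
  obtain C where "C \<ge> 0"
    and "\<forall>\<^sub>F h in at_right 0. 0 < h \<and> h < 1 \<and> (\<forall>\<tau>\<in>{0..1}. norm (f' h \<tau>) \<le> C * h ^ k)"
    using f' by (rule unif_bigoE)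
  \<comment> \<open>The intermediate point lies anywhere between 0 and \<open>h\<close>, so the
    bound is needed on a whole interval with an explicit end.\<close>
  then obtain b where b: "b > 0"
    "\<And>h \<tau>. 0 < h \<Longrightarrow> h < b \<Longrightarrow> \<tau> \<in> {0..1} \<Longrightarrow> \<bar>f' h \<tau>\<bar> \<le> C * h ^ k"
    by (auto simp: eventually_at_right_field)
  have "\<bar>f h \<tau>\<bar> \<le> C * h ^ Suc k" if h: "0 < h" "h < b" and \<tau>: "\<tau> \<in> {0..1}" for h \<tau>
  proof -
    obtain z where z: "0 < z" "z < h" "f h \<tau> - f 0 \<tau> = (h - 0) * f' z \<tau>"
      using MVT2[of 0 h "\<lambda>s. f s \<tau>" "\<lambda>s. f' s \<tau>"] assms(2)[OF \<tau>] h by auto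
    have "\<bar>f' z \<tau>\<bar> \<le> C * z ^ k"
      using b(2)[of z] z h \<tau> by simp
    also have "\<dots> \<le> C * h ^ k"
      using z \<open>C \<ge> 0\<close> by (intro mult_left_mono power_mono) auto
    finally have "h * \<bar>f' z \<tau>\<bar> \<le> h * (C * h ^ k)"
      using h by (intro mult_left_mono) auto
    then show ?thesis
      using z assms(3)[OF \<tau>] h by (simp add: abs_mult mult_ac)
  qed
  then show ?thesis
    using b(1) by (intro unif_bigoI[of _ C]) (auto simp: eventually_at_right_field)
qed

text \<open>Here the interval in \<tau> has length at most 1, and the additional order comes from
  the factor \<open>h\<close> of the rescaled derivative.\<close>

lemma unif_bigo_integrate_time:
  fixes f :: "real \<Rightarrow> real \<Rightarrow> real"
  assumes f': "unif_bigo k f'"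
    and "\<forall>\<^sub>F h in at_right 0. f h 0 = 0 \<and>
      (\<forall>\<tau>\<in>{0..1}. (f h has_real_derivative h * f' h \<tau>) (at \<tau> within {0..1}))"
  shows "unif_bigo (Suc k) f"
proof -
  obtain C where "C \<ge> 0"
    and C: "\<forall>\<^sub>F h in at_right 0. 0 < h \<and> h < 1 \<and> (\<forall>\<tau>\<in>{0..1}. norm (f' h \<tau>) \<le> C * h ^ k)"
    using f' by (rule unif_bigoE)
  show ?thesis
  proof (rule unif_bigoI)
    show "\<forall>\<^sub>F h in at_right 0. h > 0 \<longrightarrow> h < 1 \<longrightarrow> (\<forall>\<tau>\<in>{0..1}. norm (f h \<tau>) \<le> C * h ^ Suc k)"
      using C assms(2)
    proof eventually_elim
      case (elim h)
      have "norm (f h \<tau>) \<le> C * h ^ Suc k" if \<tau>: "\<tau> \<in> {0..1}" for \<tau>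
      proof -
        have "norm (h * f' h t) \<le> h * (C * h ^ k)" if "t \<in> {0..1}" for t
          using elim that by (auto simp: abs_mult)
        then have "norm (f h \<tau> - f h 0) \<le> h * (C * h ^ k) * norm (\<tau> - 0)"
          using elim \<tau> by (intro field_differentiable_bound[of "{0..1}" "f h" "\<lambda>t. h * f' h t"]) auto
        also have "\<dots> \<le> h * (C * h ^ k) * 1"
          using \<tau> elim \<open>C \<ge> 0\<close> by (intro mult_left_mono) auto
        finally show ?thesis
          using elim by (simp add: mult_ac)
      qed
      then show ?case by blast
    qed
  qed
qed

section \<open>Graded polynomial expansions\<close>

text \<open>For \<open>s = 0\<close> these are the polynomials in \<open>h\<close> and \<open>h \<tau>\<close>: the coefficient of \<open>h\<^sup>n\<close> has degree at most
  \<open>n\<close> in \<open>\<tau>\<close>. A derivative in \<open>h\<close> raises the defect \<open>s\<close> by one.\<close>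

inductive graded_poly :: "nat \<Rightarrow> (real \<Rightarrow> real \<Rightarrow> real) \<Rightarrow> bool" for s where
  zero: "graded_poly s (\<lambda>h \<tau>. 0)"
| add_monom: "graded_poly s p \<Longrightarrow> m \<le> n + s \<Longrightarrow> graded_poly s (\<lambda>h \<tau>. p h \<tau> + c * h ^ n * \<tau> ^ m)"

lemma graded_poly_monom: "m \<le> n + s \<Longrightarrow> graded_poly s (\<lambda>h \<tau>. c * h ^ n * \<tau> ^ m)"
  using add_monom[OF zero, of m n s c] by simp

lemma graded_poly_const: "graded_poly 0 (\<lambda>h \<tau>. c)"
  using graded_poly_monom[of 0 0 0 c] by simp

lemma graded_poly_add:
  assumes "graded_poly s p" and "graded_poly s q"
  shows "graded_poly s (\<lambda>h \<tau>. p h \<tau> + q h \<tau>)"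
  using assms(2)
proof induction
  case (add_monom q m n c)
  then show ?case
    using graded_poly.add_monom[of s "\<lambda>h \<tau>. p h \<tau> + q h \<tau>" m n c] by (simp add: add.assoc)
qed (use assms(1) in simp)

lemma graded_poly_sum:
  assumes "\<And>i. i \<in> I \<Longrightarrow> graded_poly s (p i)"
  shows "graded_poly s (\<lambda>h \<tau>. \<Sum>i\<in>I. p i h \<tau>)"
  using assms
  by (induction I rule: infinite_finite_induct) (auto intro: graded_poly_add graded_poly.zero)

lemma graded_poly_mult_monom:
  assumes "graded_poly s p" and "m \<le> n + t"
  shows "graded_poly (s + t) (\<lambda>h \<tau>. p h \<tau> * (c * h ^ n * \<tau> ^ m))"
  using assms(1)
proof induction
  case (add_monom p m' n' c')
  have "graded_poly (s + t) (\<lambda>h \<tau>. p h \<tau> * (c * h ^ n * \<tau> ^ m) + (c' * c) * h ^ (n' + n) * \<tau> ^ (m' + m))"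
    using add_monom assms(2) by (intro graded_poly.add_monom) auto
  then show ?case by (simp add: algebra_simps power_add)
qed (simp add: graded_poly.zero)

text \<open>Exponents of \<open>h\<close> and of \<tau> add, hence so do the permitted excesses of
  degree.\<close>

lemma graded_poly_mult:
  assumes "graded_poly s p" and "graded_poly t q"
  shows "graded_poly (s + t) (\<lambda>h \<tau>. p h \<tau> * q h \<tau>)"
  using assms(2)
proof induction
  case (add_monom q m n c)
  from graded_poly_add[OF add_monom.IH graded_poly_mult_monom[OF assms(1) add_monom.hyps(2), of c]]
  show ?case by (simp add: distrib_left)
qed (simp add: graded_poly.zero)

lemma graded_poly_bounded:
  assumes "graded_poly s p"
  shows "\<exists>B. \<forall>h\<in>{0..1}. \<forall>\<tau>\<in>{0..1}. \<bar>p h \<tau>\<bar> \<le> B"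
  using assms
proof induction
  case (add_monom p m n c)
  then obtain B where B: "\<And>h \<tau>. h \<in> {0..1} \<Longrightarrow> \<tau> \<in> {0..1} \<Longrightarrow> \<bar>p h \<tau>\<bar> \<le> B"
    by blast
  have "\<bar>p h \<tau> + c * h ^ n * \<tau> ^ m\<bar> \<le> B + \<bar>c\<bar>" if "h \<in> {0..1}" "\<tau> \<in> {0..1}" for h \<tau>
  proof -
    have "h ^ n * \<tau> ^ m \<le> 1"
      using that by (intro mult_le_one power_le_one) auto
    then have "\<bar>c\<bar> * (h ^ n * \<tau> ^ m) \<le> \<bar>c\<bar> * 1"
      by (intro mult_left_mono) auto
    then have "\<bar>c * h ^ n * \<tau> ^ m\<bar> \<le> \<bar>c\<bar>"
      using that by (simp add: abs_mult mult.assoc)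
    then show ?thesis
      using B[OF that] by linarith
  qed
  then show ?case by blast
qed (auto intro: exI[of _ 0])

lemma graded_poly_continuous: "graded_poly s p \<Longrightarrow> continuous_on S (p h)"
  by (induction rule: graded_poly.induct) (auto intro!: continuous_intros)

text \<open>At \<open>h = 0\<close> only terms with \<open>n = 0\<close> survive, and defect 0
  forces \<open>m = 0\<close> in them.\<close>

lemma graded_poly_step_0: "graded_poly 0 p \<Longrightarrow> p 0 \<tau> = p 0 0"
  by (induction rule: graded_poly.induct) (auto simp: power_0_left)

lemma graded_poly_step_derivative:
  assumes "graded_poly 0 p"
  shows "\<exists>p'. graded_poly 1 p' \<and> (\<forall>h \<tau>. ((\<lambda>s. p s \<tau>) has_real_derivative p' h \<tau>) (at h))"
  using assms
proof induction
  case zero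
  then show ?case by (auto intro!: exI[of _ "\<lambda>h \<tau>. 0"] graded_poly.zero)
next
  case (add_monom p m n c)
  then obtain p' where p': "graded_poly 1 p'"
    "\<And>h \<tau>. ((\<lambda>s. p s \<tau>) has_real_derivative p' h \<tau>) (at h)"
    by blast
  have "graded_poly 1 (\<lambda>h \<tau>. p' h \<tau> + (c * real n) * h ^ (n - 1) * \<tau> ^ m)"
    \<comment> \<open>For \<open>n = 0\<close> the truncated exponent \<open>n - 1\<close> is
      harmless: the coefficient is 0, and \<open>m = 0\<close> satisfies the degree
      condition.\<close>
    using add_monom p' by (cases "n = 0") (auto intro!: graded_poly.add_monom)
  moreover have "((\<lambda>s. p s \<tau> + c * s ^ n * \<tau> ^ m) has_real_derivative
      p' h \<tau> + (c * real n) * h ^ (n - 1) * \<tau> ^ m) (at h)" for h \<tau>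
    by (rule derivative_eq_intros p' refl)+ (simp add: mult_ac)
  ultimately show ?case by blast
qed

text \<open>The new power of \<open>h\<close> absorbs the excess 1, so integration in
  \<open>h\<close> undoes the loss caused by differentiation.\<close>

lemma graded_poly_step_antiderivative:
  assumes "graded_poly 1 p"
  shows "\<exists>P. graded_poly 0 P \<and> (\<forall>\<tau>. P 0 \<tau> = 0) \<and>
    (\<forall>h \<tau>. ((\<lambda>s. P s \<tau>) has_real_derivative p h \<tau>) (at h))"
  using assms
proof induction
  case zero
  then show ?case by (auto intro!: exI[of _ "\<lambda>h \<tau>. 0"] graded_poly.zero)
next
  case (add_monom p m n c)
  then obtain P where P: "graded_poly 0 P" "\<And>\<tau>. P 0 \<tau> = 0"
    "\<And>h \<tau>. ((\<lambda>s. P s \<tau>) has_real_derivative p h \<tau>) (at h)"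
    by blast
  have "graded_poly 0 (\<lambda>h \<tau>. P h \<tau> + (c / real (Suc n)) * h ^ Suc n * \<tau> ^ m)"
    using add_monom P by (intro graded_poly.add_monom) auto
  moreover have "((\<lambda>s. P s \<tau> + (c / real (Suc n)) * s ^ Suc n * \<tau> ^ m) has_real_derivative
      p h \<tau> + c * h ^ n * \<tau> ^ m) (at h)" for h \<tau>
    by (rule derivative_eq_intros P refl)+ (simp add: field_simps del: of_nat_Suc)
  ultimately show ?case
    using P(2) by (intro exI[of _ "\<lambda>h \<tau>. P h \<tau> + (c / real (Suc n)) * h ^ Suc n * \<tau> ^ m"]) auto
qed

text \<open>The exponents of \<open>h\<close> and \<tau> both grow by one, so the defect stays 0.
  Without the factor \<open>h\<close> it would not.\<close>

lemma graded_poly_time_antiderivative: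
  assumes "graded_poly 0 p"
  shows "\<exists>P. graded_poly 0 P \<and> (\<forall>h. P h 0 = 0) \<and>
    (\<forall>h \<tau>. (P h has_real_derivative h * p h \<tau>) (at \<tau>))"
  using assms
proof induction
  case zero
  then show ?case by (auto intro!: exI[of _ "\<lambda>h \<tau>. 0"] graded_poly.zero)
next
  case (add_monom p m n c)
  then obtain P where P: "graded_poly 0 P" "\<And>h. P h 0 = 0"
    "\<And>h \<tau>. (P h has_real_derivative h * p h \<tau>) (at \<tau>)"
    by blast
  have "graded_poly 0 (\<lambda>h \<tau>. P h \<tau> + (c / real (Suc m)) * h ^ Suc n * \<tau> ^ Suc m)"
    using add_monom P by (intro graded_poly.add_monom) auto
  moreover have "((\<lambda>t. P h t + (c / real (Suc m)) * h ^ Suc n * t ^ Suc m) has_real_derivative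
      h * (p h \<tau> + c * h ^ n * \<tau> ^ m)) (at \<tau>)" for h \<tau>
    by (rule derivative_eq_intros P refl)+ (simp add: field_simps del: of_nat_Suc)
  ultimately show ?case
    using P(2) by (intro exI[of _ "\<lambda>h \<tau>. P h \<tau> + (c / real (Suc m)) * h ^ Suc n * \<tau> ^ Suc m"]) auto
qed

section \<open>Taylor expansion in \<open>h\<close> and regularity of graded polynomials\<close>

lemma monom_step_derivatives:
  fixes c :: real and m N :: nat
  \<comment> \<open>The product \<open>fact n * (N choose n)\<close> is the falling factorial from
    differentiating \<open>h ^ N\<close> repeatedly. It vanishes for \<open>n > N\<close>, where
    \<open>N - n\<close> is truncated to 0 and \<open>0 ^ 0 = 1\<close> would otherwise spoil the
    value at \<open>h = 0\<close>.\<close>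
  defines "D \<equiv> \<lambda>n h \<tau>. c * (fact n * real (N choose n)) * h ^ (N - n) * \<tau> ^ m"
  shows "((\<lambda>s. D n s \<tau>) has_real_derivative D (Suc n) h \<tau>) (at h)"
    and "1 / fact n * D n 0 \<tau> = (if n = N then c * \<tau> ^ m else 0)"
proof -
  have "(N - n) * (N choose n) = Suc n * (N choose Suc n)"
    using Suc_times_binomial_eq binomial_absorb_comp binomial_absorption by metis
  then have "real (N - n) * real (N choose n) = real (Suc n) * real (N choose Suc n)"
    by (metis of_nat_mult)
  then have "c * (fact n * real (N choose n)) * (real (N - n) * h ^ (N - Suc n)) * \<tau> ^ m
      = D (Suc n) h \<tau>"
    unfolding D_def by (simp add: mult_ac del: of_nat_Suc binomial_Suc_Suc)
  moreover have "((\<lambda>s. D n s \<tau>) has_real_derivative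
      c * (fact n * real (N choose n)) * (real (N - n) * h ^ (N - Suc n)) * \<tau> ^ m) (at h)"
    unfolding D_def by (auto intro!: derivative_eq_intros)
  ultimately show "((\<lambda>s. D n s \<tau>) has_real_derivative D (Suc n) h \<tau>) (at h)"
    by simp
  show "1 / fact n * D n 0 \<tau> = (if n = N then c * \<tau> ^ m else 0)"
    unfolding D_def by (cases n N rule: linorder_cases) (auto simp: power_0_left)
qed

text \<open>The scalar counterpart of the data in \<open>regular\<close>, with one \<open>D\<close>
  for all orders \<open>r\<close> at once and derivatives on the whole line, in a form suited to
  induction over monomials.\<close>

definition step_derivatives :: "(real \<Rightarrow> real \<Rightarrow> real) \<Rightarrow> (nat \<Rightarrow> real \<Rightarrow> real \<Rightarrow> real) \<Rightarrow> bool" where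
  "step_derivatives p D \<longleftrightarrow> (\<forall>h \<tau>. D 0 h \<tau> = p h \<tau>) \<and>
    (\<forall>n h \<tau>. ((\<lambda>s. D n s \<tau>) has_real_derivative D (Suc n) h \<tau>) (at h)) \<and>
    (\<forall>n. \<exists>q::real poly. degree q \<le> n \<and> (\<forall>\<tau>. 1 / fact n * D n 0 \<tau> = poly q \<tau>)) \<and>
    (\<forall>r. unif_bigo r (\<lambda>h \<tau>. p h \<tau> - (\<Sum>n<r. h ^ n * (1 / fact n * D n 0 \<tau>))))"

lemma graded_poly_taylor:
  assumes "graded_poly 0 p"
  shows "\<exists>D. step_derivatives p D"
  using assms
proof induction
  case zero
  then show ?case
    by (intro exI[of _ "\<lambda>n h \<tau>. 0"]) (auto simp: step_derivatives_def intro: unif_bigo_zero exI[of _ 0])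
next
  case (add_monom p m N c)
  then obtain D where D: "\<And>h \<tau>. D 0 h \<tau> = p h \<tau>"
    "\<And>n h \<tau>. ((\<lambda>s. D n s \<tau>) has_real_derivative D (Suc n) h \<tau>) (at h)"
    "\<And>n. \<exists>q::real poly. degree q \<le> n \<and> (\<forall>\<tau>. 1 / fact n * D n 0 \<tau> = poly q \<tau>)"
    "\<And>r. unif_bigo r (\<lambda>h \<tau>. p h \<tau> - (\<Sum>n<r. h ^ n * (1 / fact n * D n 0 \<tau>)))"
    unfolding step_derivatives_def by blast
  define E where "E n h \<tau> = c * (fact n * real (N choose n)) * h ^ (N - n) * \<tau> ^ m" for n h \<tau>
  note E = monom_step_derivatives[where c = c and N = N and m = m, folded E_def]
  have "\<exists>q::real poly. degree q \<le> n \<and> (\<forall>\<tau>. 1 / fact n * (D n 0 \<tau> + E n 0 \<tau>) = poly q \<tau>)" for n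
  proof -
    obtain q :: "real poly" where q: "degree q \<le> n" "\<And>\<tau>. 1 / fact n * D n 0 \<tau> = poly q \<tau>"
      using D(3) by blast
    have "degree (q + (if n = N then monom c m else 0)) \<le> n"
      using q(1) add_monom.hyps degree_monom_le[of c m] by (auto intro!: degree_add_le)
    moreover have "1 / fact n * (D n 0 \<tau> + E n 0 \<tau>) = poly (q + (if n = N then monom c m else 0)) \<tau>" for \<tau>
      by (simp only: distrib_left q E(2)) (simp add: poly_monom)
    ultimately show ?thesis by blast
  qed
  moreover have "unif_bigo r (\<lambda>h \<tau>. p h \<tau> + c * h ^ N * \<tau> ^ m
      - (\<Sum>n<r. h ^ n * (1 / fact n * (D n 0 \<tau> + E n 0 \<tau>))))" for r
  proof -
    have "unif_bigo N (\<lambda>h \<tau>. c * h ^ N * \<tau> ^ m)"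
    proof (rule unif_bigoI[OF always_eventually], intro allI impI ballI)
      fix h \<tau> :: real assume "0 < h" "\<tau> \<in> {0..1}"
      then have "(\<bar>c\<bar> * h ^ N) * \<tau> ^ m \<le> (\<bar>c\<bar> * h ^ N) * 1"
        by (intro mult_left_mono power_le_one) auto
      with \<open>0 < h\<close> \<open>\<tau> \<in> {0..1}\<close> show "norm (c * h ^ N * \<tau> ^ m) \<le> \<bar>c\<bar> * h ^ N"
        by (simp add: abs_mult)
    qed
    \<comment> \<open>For \<open>N < r\<close> the monomial is its own Taylor term and cancels;
      otherwise it belongs to the remainder and has order \<open>N \<ge> r\<close>.\<close>
    then have "unif_bigo r (\<lambda>h \<tau>. if N < r then 0 else c * h ^ N * \<tau> ^ m)"
      by (cases "N < r") (simp_all add: unif_bigo_zero unif_bigo_weaken)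
    from unif_bigo_add[OF D(4)[of r] this] show ?thesis
    proof (rule unif_bigo_cong, intro always_eventually allI ballI)
      fix h \<tau> :: real
      have "(\<Sum>n<r. h ^ n * (1 / fact n * (D n 0 \<tau> + E n 0 \<tau>)))
          = (\<Sum>n<r. h ^ n * (1 / fact n * D n 0 \<tau>)) + (\<Sum>n<r. if n = N then h ^ n * (c * \<tau> ^ m) else 0)"
        unfolding sum.distrib[symmetric]
        by (intro sum.cong refl) (simp only: distrib_left E(2), simp)
      then show "p h \<tau> + c * h ^ N * \<tau> ^ m - (\<Sum>n<r. h ^ n * (1 / fact n * (D n 0 \<tau> + E n 0 \<tau>)))
          = p h \<tau> - (\<Sum>n<r. h ^ n * (1 / fact n * D n 0 \<tau>)) + (if N < r then 0 else c * h ^ N * \<tau> ^ m)"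
        by (simp add: sum.delta mult_ac)
    qed
  qed
  moreover have "((\<lambda>s. D n s \<tau> + E n s \<tau>) has_real_derivative D (Suc n) h \<tau> + E (Suc n) h \<tau>) (at h)" for n h \<tau>
    by (intro DERIV_add D(2) E(1))
  moreover have "D 0 h \<tau> + E 0 h \<tau> = p h \<tau> + c * h ^ N * \<tau> ^ m" for h \<tau>
    by (simp add: D(1) E_def)
  ultimately show ?case
    unfolding step_derivatives_def by (intro exI[of _ "\<lambda>n h \<tau>. D n h \<tau> + E n h \<tau>"]) blast
qed

lemma graded_poly_regular:
  fixes p :: "'d::finite \<Rightarrow> real \<Rightarrow> real \<Rightarrow> real"
  assumes "\<And>i. graded_poly 0 (p i)"
  shows "regular r (\<lambda>h \<tau>. \<chi> i. p i h \<tau>)"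
proof -
  obtain D where "\<And>i. step_derivatives (p i) (D i)"
    using graded_poly_taylor[OF assms] by metis
  then have D: "\<And>i h \<tau>. D i 0 h \<tau> = p i h \<tau>"
    "\<And>i n h \<tau>. ((\<lambda>s. D i n s \<tau>) has_real_derivative D i (Suc n) h \<tau>) (at h)"
    "\<And>i n. \<exists>q::real poly. degree q \<le> n \<and> (\<forall>\<tau>. 1 / fact n * D i n 0 \<tau> = poly q \<tau>)"
    "\<And>i r. unif_bigo r (\<lambda>h \<tau>. p i h \<tau> - (\<Sum>n<r. h ^ n * (1 / fact n * D i n 0 \<tau>)))"
    unfolding step_derivatives_def by blast+
  define E :: "nat \<Rightarrow> real \<Rightarrow> real \<Rightarrow> real^'d" where "E n h \<tau> = (\<chi> i. D i n h \<tau>)" for n h \<tau>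
  have "((\<lambda>s. E n s \<tau>) has_vector_derivative E (Suc n) h \<tau>) (at h within S)" for n h \<tau> S
    using D(2) by (intro has_vector_derivative_componentwise)
      (auto simp: E_def has_real_derivative_iff_has_vector_derivative[symmetric]
        intro: has_field_derivative_at_within)
  moreover have "poly_entries n (\<lambda>\<tau>. (1 / fact n) *\<^sub>R E n 0 \<tau>)" for n
    unfolding poly_entries_def
  proof
    fix i
    obtain q :: "real poly" where "degree q \<le> n" "\<And>\<tau>. 1 / fact n * D i n 0 \<tau> = poly q \<tau>"
      using D(3) by blast
    then show "\<exists>q::real poly. degree q \<le> n \<and> (\<forall>\<tau>\<in>{0..1}. ((1 / fact n) *\<^sub>R E n 0 \<tau>) $ i = poly q \<tau>)"
      by (intro exI[of _ q]) (simp add: E_def)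
  qed
  moreover have "unif_bigo r (\<lambda>h \<tau>. (\<chi> i. p i h \<tau>) - (\<Sum>n<r. h ^ n *\<^sub>R ((1 / fact n) *\<^sub>R E n 0 \<tau>)))"
    using D(4)[of r] by (auto simp: unif_bigo_vec_iff E_def)
  moreover have "continuous_on {0..1} (\<lambda>\<tau>. \<chi> i. p i h \<tau>)" for h
    by (intro continuous_on_vec_lambda graded_poly_continuous[OF assms])
  moreover have "E 0 h \<tau> = (\<chi> i. p i h \<tau>)" for h \<tau>
    by (simp add: E_def D(1))
  ultimately show ?thesis
    unfolding regular_def by (intro exI[of _ 1] conjI exI[of _ E]) auto
qed

text \<open>In contrast to \<open>regular\<close>, nothing is asked of \<open>w\<close> concerning
  derivatives in \<open>h\<close>, so it can be proved for a family of solutions from estimates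
  alone.\<close>

definition graded_expansion :: "nat \<Rightarrow> (real \<Rightarrow> real \<Rightarrow> real^'d) \<Rightarrow> bool" where
  "graded_expansion k w \<longleftrightarrow>
    (\<exists>p. (\<forall>i. graded_poly 0 (p i)) \<and> unif_bigo k (\<lambda>h \<tau>. w h \<tau> - (\<chi> i. p i h \<tau>)))"

lemma graded_poly_vec_bounded:
  fixes p :: "'d::finite \<Rightarrow> real \<Rightarrow> real \<Rightarrow> real"
  assumes "\<And>i. graded_poly 0 (p i)"
  obtains B where "\<And>h \<tau>. h \<in> {0..1} \<Longrightarrow> \<tau> \<in> {0..1} \<Longrightarrow> norm (\<chi> i. p i h \<tau>) \<le> B"
proof -
  have "\<forall>i. \<exists>B. \<forall>h\<in>{0..1}. \<forall>\<tau>\<in>{0..1}. \<bar>p i h \<tau>\<bar> \<le> B"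
    using graded_poly_bounded[OF assms] by blast
  then obtain B where B: "\<And>i h \<tau>. h \<in> {0..1} \<Longrightarrow> \<tau> \<in> {0..1} \<Longrightarrow> \<bar>p i h \<tau>\<bar> \<le> B i"
    by metis
  have "norm (\<chi> i. p i h \<tau>) \<le> (\<Sum>i\<in>UNIV. B i)" if "h \<in> {0..1}" "\<tau> \<in> {0..1}" for h \<tau>
    by (rule order_trans[OF norm_le_l1_cart sum_mono]) (use B[OF that] in simp)
  then show ?thesis by (rule that)
qed

lemma linear_vec_expansion:
  fixes F :: "real^'d \<Rightarrow> real"
  assumes "linear F"
  shows "F x = (\<Sum>i\<in>UNIV. F (axis i 1) * x $ i)"
proof -
  have "F x = F (\<Sum>i\<in>UNIV. x $ i *\<^sub>R axis i 1)"
    using basis_expansion[of x] by (simp add: scalar_mult_eq_scaleR)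
  also have "\<dots> = (\<Sum>i\<in>UNIV. x $ i * F (axis i 1))"
    by (simp add: linear_sum[OF assms] linear_cmul[OF assms])
  finally show ?thesis by (simp add: mult.commute)
qed

text \<open>By induction on the order: the \<open>h\<close>-derivative of \<open>f \<circ> p\<close> is a combination of derivatives of \<open>p\<close>
  with coefficients \<open>\<partial>f \<circ> p\<close>, to which the induction hypothesis applies.\<close>

lemma Ck_compose_graded_poly:
  fixes f :: "real^'d \<Rightarrow> real" and p :: "'d \<Rightarrow> real \<Rightarrow> real \<Rightarrow> real"
  assumes p: "\<And>i. graded_poly 0 (p i)"
  shows "Ck_on k UNIV f \<Longrightarrow>
    \<exists>q. graded_poly 0 q \<and> unif_bigo k (\<lambda>h \<tau>. f (\<chi> i. p i h \<tau>) - q h \<tau>)"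
proof (induction k arbitrary: f)
  case 0
  obtain B where B: "\<And>h \<tau>. h \<in> {0..1} \<Longrightarrow> \<tau> \<in> {0..1} \<Longrightarrow> norm (\<chi> i. p i h \<tau>) \<le> B"
    using graded_poly_vec_bounded[of p, OF p] by blast
  have "compact (f ` cball 0 B)"
    using 0 by (intro compact_continuous_image) (auto intro: continuous_on_subset)
  then obtain C where C: "\<And>x. x \<in> cball 0 B \<Longrightarrow> norm (f x) \<le> C"
    by (metis bounded_iff compact_imp_bounded imageI)
  \<comment> \<open>Order 0 means boundedness, so the zero polynomial is an expansion.\<close>
  have "unif_bigo 0 (\<lambda>h \<tau>. f (\<chi> i. p i h \<tau>) - 0)"
    by (rule unif_bigoI[OF always_eventually, where C = C]) (use B C in auto)
  then show ?case
    using graded_poly.zero by blast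
next
  case (Suc k)
  obtain f' where f': "\<And>x. (f has_derivative f' x) (at x)" and Ck: "\<And>v. Ck_on k UNIV (\<lambda>x. f' x v)"
    using Suc.prems by auto
  define P where "P h \<tau> = (\<chi> i. p i h \<tau>)" for h \<tau>
  have "\<forall>i. \<exists>q. graded_poly 0 q \<and> unif_bigo k (\<lambda>h \<tau>. f' (P h \<tau>) (axis i 1) - q h \<tau>)"
    unfolding P_def by (intro allI Suc.IH Ck)
  from choice[OF this] obtain q where q: "\<And>i. graded_poly 0 (q i)"
    "\<And>i. unif_bigo k (\<lambda>h \<tau>. f' (P h \<tau>) (axis i 1) - q i h \<tau>)"
    by blast
  have "\<forall>i. \<exists>p'. graded_poly 1 p' \<and> (\<forall>h \<tau>. ((\<lambda>s. p i s \<tau>) has_real_derivative p' h \<tau>) (at h))"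
    by (intro allI graded_poly_step_derivative p)
  from choice[OF this] obtain p' where p': "\<And>i. graded_poly 1 (p' i)"
    "\<And>i h \<tau>. ((\<lambda>s. p i s \<tau>) has_real_derivative p' i h \<tau>) (at h)"
    by blast
  \<comment> \<open>This is the chain rule with \<partial>\<open>f\<close> replaced by its
    expansions \<open>q i\<close>. The defects 0 and 1 add up to 1, which the antiderivative in
    \<open>h\<close> brings back to 0.\<close>
  have "graded_poly 1 (\<lambda>h \<tau>. \<Sum>i\<in>UNIV. q i h \<tau> * p' i h \<tau>)"
    using graded_poly_mult[OF q(1) p'(1)] by (intro graded_poly_sum) simp
  from graded_poly_step_antiderivative[OF this] obtain U where U: "graded_poly 0 U" "\<And>\<tau>. U 0 \<tau> = 0"
    "\<And>h \<tau>. ((\<lambda>s. U s \<tau>) has_real_derivative (\<Sum>i\<in>UNIV. q i h \<tau> * p' i h \<tau>)) (at h)"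
    by blast
  \<comment> \<open>The constant \<open>f (P 0 0)\<close> supplies the value at
    \<open>h = 0\<close>, where \<open>P\<close> does not depend on \<tau>.\<close>
  have "unif_bigo (Suc k) (\<lambda>h \<tau>. f (P h \<tau>) - (U h \<tau> + f (P 0 0)))"
  proof (rule unif_bigo_integrate_step)
    have "unif_bigo k (\<lambda>h \<tau>. (f' (P h \<tau>) (axis i 1) - q i h \<tau>) * p' i h \<tau>)" for i
    proof -
      obtain B where "\<And>h \<tau>. h \<in> {0..1} \<Longrightarrow> \<tau> \<in> {0..1} \<Longrightarrow> \<bar>p' i h \<tau>\<bar> \<le> B"
        using graded_poly_bounded[OF p'(1)] by blast
      then show ?thesis by (rule unif_bigo_mult_bounded[OF q(2)])
    qed
    then show "unif_bigo k (\<lambda>h \<tau>. \<Sum>i\<in>UNIV. (f' (P h \<tau>) (axis i 1) - q i h \<tau>) * p' i h \<tau>)"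
      by (intro unif_bigo_sum)
  next
    fix h \<tau> :: real
    have "((\<lambda>s. P s \<tau>) has_vector_derivative (\<chi> i. p' i h \<tau>)) (at h)"
      unfolding P_def using p'(2) by (intro has_vector_derivative_componentwise)
        (auto simp: has_real_derivative_iff_has_vector_derivative[symmetric])
    from has_derivative_compose[OF this[unfolded has_vector_derivative_def] f']
    have "((\<lambda>s. f (P s \<tau>)) has_derivative (\<lambda>x. f' (P h \<tau>) (x *\<^sub>R (\<chi> i. p' i h \<tau>)))) (at h)" .
    then have "((\<lambda>s. f (P s \<tau>)) has_real_derivative f' (P h \<tau>) (\<chi> i. p' i h \<tau>)) (at h)"
      unfolding has_field_derivative_def
      by (rule has_derivative_eq_rhs)
        (simp add: fun_eq_iff linear_cmul[OF has_derivative_linear[OF f']])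
    from DERIV_diff[OF this DERIV_add[OF U(3) DERIV_const[of "f (P 0 0)"]]]
    show "((\<lambda>s. f (P s \<tau>) - (U s \<tau> + f (P 0 0))) has_real_derivative
        (\<Sum>i\<in>UNIV. (f' (P h \<tau>) (axis i 1) - q i h \<tau>) * p' i h \<tau>)) (at h)"
      by (simp add: linear_vec_expansion[OF has_derivative_linear[OF f'], of _ "\<chi> i. p' i h \<tau>"]
          left_diff_distrib sum_subtractf)
  next
    fix \<tau> :: real
    have "P 0 \<tau> = P 0 0"
      unfolding P_def using graded_poly_step_0[OF p, of _ \<tau>] by simp
    then show "f (P 0 \<tau>) - (U 0 \<tau> + f (P 0 0)) = 0"
      by (simp add: U(2))
  qed
  then show ?case
    using graded_poly_add[OF U(1) graded_poly_const[of "f (P 0 0)"]] unfolding P_def by blast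
qed

text \<open>\<open>Ck_on\<close> gives continuity of the derivative direction by direction, so
  compactness is applied to each basis vector and the bounds are summed to one for the operator
  norm. The mean value inequality on the convex ball concludes.\<close>

lemma C1_lipschitz_on_cball:
  fixes f :: "'a::euclidean_space \<Rightarrow> real"
  assumes "Ck_on 1 UNIV f"
  obtains L where "L \<ge> 0"
    and "\<And>x y. norm x \<le> B \<Longrightarrow> norm y \<le> B \<Longrightarrow> \<bar>f x - f y\<bar> \<le> L * norm (x - y)"
proof -
  obtain f' where f': "\<And>x. (f has_derivative f' x) (at x)"
    and cont: "\<And>v. continuous_on UNIV (\<lambda>x. f' x v)"
    using assms by auto
  have "\<exists>K. \<forall>x\<in>cball 0 B. \<bar>f' x b\<bar> \<le> K" for b
  proof -
    have "compact ((\<lambda>x. f' x b) ` cball 0 B)"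
      using cont by (intro compact_continuous_image) (auto intro: continuous_on_subset)
    then show ?thesis
      by (metis bounded_iff compact_imp_bounded imageI real_norm_def)
  qed
  then obtain K where K: "\<And>b x. x \<in> cball 0 B \<Longrightarrow> \<bar>f' x b\<bar> \<le> K b"
    by metis
  \<comment> \<open>Absolute values because for negative \<open>B\<close> the ball is empty and
    \<open>K b\<close> may have any sign.\<close>
  define L where "L = (\<Sum>b\<in>Basis. \<bar>K b\<bar>)"
  have "onorm (f' x) \<le> L" if x: "x \<in> cball 0 B" for x
  proof (rule onorm_le)
    fix v
    have lin: "linear (f' x)"
      using f' by (rule has_derivative_linear)
    have "f' x v = f' x (\<Sum>b\<in>Basis. (v \<bullet> b) *\<^sub>R b)"
      by (simp add: euclidean_representation)
    also have "\<dots> = (\<Sum>b\<in>Basis. (v \<bullet> b) * f' x b)"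
      by (simp add: linear_sum[OF lin] linear_cmul[OF lin])
    finally have "norm (f' x v) \<le> (\<Sum>b\<in>Basis. \<bar>v \<bullet> b\<bar> * \<bar>f' x b\<bar>)"
      by (simp add: order_trans[OF sum_abs] abs_mult)
    also have "\<dots> \<le> (\<Sum>b\<in>Basis. norm v * \<bar>K b\<bar>)"
      using K[OF x] by (intro sum_mono mult_mono) (auto simp: Basis_le_norm intro: order_trans[OF _ abs_ge_self])
    finally show "norm (f' x v) \<le> L * norm v"
      by (simp add: L_def sum_distrib_left mult.commute)
  qed
  then have "norm (f x - f y) \<le> L * norm (x - y)" if "norm x \<le> B" "norm y \<le> B" for x y
    using that f' by (intro differentiable_bound[of "cball 0 B" f f'])
      (auto intro: has_derivative_at_withinI)
  then show ?thesis
    by (intro that[of L]) (auto simp: L_def intro: sum_nonneg)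
qed

section \<open>Order of the projection defects\<close>

lemma graded_expansion_add:
  assumes "graded_expansion k v" and "graded_expansion k w"
  shows "graded_expansion k (\<lambda>h \<tau>. v h \<tau> + w h \<tau>)"
proof -
  obtain p where p: "\<And>i. graded_poly 0 (p i)" "unif_bigo k (\<lambda>h \<tau>. v h \<tau> - (\<chi> i. p i h \<tau>))"
    using assms(1) by (auto simp: graded_expansion_def)
  obtain q where q: "\<And>i. graded_poly 0 (q i)" "unif_bigo k (\<lambda>h \<tau>. w h \<tau> - (\<chi> i. q i h \<tau>))"
    using assms(2) by (auto simp: graded_expansion_def)
  have "(v h \<tau> - (\<chi> i. p i h \<tau>)) + (w h \<tau> - (\<chi> i. q i h \<tau>))
      = (v h \<tau> + w h \<tau>) - (\<chi> i. p i h \<tau> + q i h \<tau>)" for h \<tau>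
    by (simp add: vec_eq_iff)
  with unif_bigo_add[OF p(2) q(2)] show ?thesis
    unfolding graded_expansion_def
    by (intro exI[of _ "\<lambda>i h \<tau>. p i h \<tau> + q i h \<tau>"]) (simp add: graded_poly_add p(1) q(1))
qed

lemma graded_expansion_matrix_vector_mult:
  fixes A :: "real^'d^'d"
  assumes "graded_expansion k w"
  shows "graded_expansion k (\<lambda>h \<tau>. A *v w h \<tau>)"
proof -
  obtain p where p: "\<And>i. graded_poly 0 (p i)" "unif_bigo k (\<lambda>h \<tau>. w h \<tau> - (\<chi> i. p i h \<tau>))"
    using assms by (auto simp: graded_expansion_def)
  have "graded_poly 0 (\<lambda>h \<tau>. A $ i $ j * p j h \<tau>)" for i j
    using graded_poly_mult[OF graded_poly_const p(1)] by simp
  then have "graded_poly 0 (\<lambda>h \<tau>. \<Sum>j\<in>UNIV. A $ i $ j * p j h \<tau>)" for i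
    by (intro graded_poly_sum)
  moreover have "A *v (w h \<tau> - (\<chi> i. p i h \<tau>)) = A *v w h \<tau> - (\<chi> i. \<Sum>j\<in>UNIV. A $ i $ j * p j h \<tau>)" for h \<tau>
    by (simp add: vec_eq_iff matrix_vector_mult_def right_diff_distrib sum_subtractf)
  ultimately show ?thesis
    using unif_bigo_matrix_vector_mult[OF p(2), of A] unfolding graded_expansion_def
    by (intro exI[of _ "\<lambda>i h \<tau>. \<Sum>j\<in>UNIV. A $ i $ j * p j h \<tau>"]) simp
qed

text \<open>\<open>g\<close> is expanded along the polynomial \<open>P\<close> approximating
  \<open>u\<close>; passing from \<open>P\<close> to \<open>u\<close> costs a Lipschitz constant on
  a ball of radius \<open>max B B'\<close>, which contains the values of both.\<close>

lemma graded_expansion_compose: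
  fixes g :: "real^'d \<Rightarrow> real^'d"
  assumes g: "\<And>k i. Ck_on k UNIV (\<lambda>y. g y $ i)" and u: "graded_expansion k u"
    and B: "\<forall>\<^sub>F h in at_right 0. \<forall>\<tau>\<in>{0..1}. norm (u h \<tau>) \<le> B"
  shows "graded_expansion k (\<lambda>h \<tau>. g (u h \<tau>))"
proof -
  obtain p where p: "\<And>i. graded_poly 0 (p i)" "unif_bigo k (\<lambda>h \<tau>. u h \<tau> - (\<chi> i. p i h \<tau>))"
    using u by (auto simp: graded_expansion_def)
  define P where "P h \<tau> = (\<chi> i. p i h \<tau>)" for h \<tau>
  obtain B' where B': "\<And>h \<tau>. h \<in> {0..1} \<Longrightarrow> \<tau> \<in> {0..1} \<Longrightarrow> norm (P h \<tau>) \<le> B'"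
    using graded_poly_vec_bounded[of p, OF p(1)] unfolding P_def by blast
  have "\<forall>i. \<exists>q. graded_poly 0 q \<and> unif_bigo k (\<lambda>h \<tau>. g (P h \<tau>) $ i - q h \<tau>)"
    unfolding P_def by (intro allI Ck_compose_graded_poly[OF p(1) g])
  from choice[OF this] obtain q where q: "\<And>i. graded_poly 0 (q i)"
    "\<And>i. unif_bigo k (\<lambda>h \<tau>. g (P h \<tau>) $ i - q i h \<tau>)"
    by blast
  have "unif_bigo k (\<lambda>h \<tau>. g (u h \<tau>) $ i - q i h \<tau>)" for i
  proof -
    obtain L where L: "L \<ge> 0" "\<And>x y. norm x \<le> max B B' \<Longrightarrow> norm y \<le> max B B' \<Longrightarrow>
        \<bar>g x $ i - g y $ i\<bar> \<le> L * norm (x - y)"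
      using C1_lipschitz_on_cball[OF g] by blast
    have "unif_bigo k (\<lambda>h \<tau>. g (u h \<tau>) $ i - g (P h \<tau>) $ i)"
    proof (rule unif_bigo_bound[OF p(2)[folded P_def] _ L(1)])
      show "\<forall>\<^sub>F h in at_right 0. \<forall>\<tau>\<in>{0..1}.
          norm (g (u h \<tau>) $ i - g (P h \<tau>) $ i) \<le> L * norm (u h \<tau> - P h \<tau>)"
        using B eventually_at_right_real[OF zero_less_one]
      proof eventually_elim
        case (elim h)
        show ?case
        proof
          fix \<tau> :: real assume "\<tau> \<in> {0..1}"
          with elim B'[of h \<tau>] show "norm (g (u h \<tau>) $ i - g (P h \<tau>) $ i) \<le> L * norm (u h \<tau> - P h \<tau>)"
            unfolding real_norm_def by (intro L(2)) (auto simp: le_max_iff_disj)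
        qed
      qed
    qed
    from unif_bigo_add[OF this q(2)[of i]] show ?thesis by simp
  qed
  with q(1) show ?thesis
    unfolding graded_expansion_def by (intro exI[of _ q]) (simp add: unif_bigo_vec_iff)
qed

section \<open>The projection for small \<open>h\<close>\<close>

lemma kernel_bounded:
  assumes "kernel_extends_smoothly r \<psi>"
  obtains K where "\<forall>\<^sub>F h in at_right 0. \<forall>\<tau>\<in>{0..1}. \<forall>\<sigma>\<in>{0..1}. \<bar>kernel r (\<psi> h) \<tau> \<sigma>\<bar> \<le> K"
proof -
  obtain h0 and D :: "nat \<Rightarrow> real \<Rightarrow> real \<Rightarrow> real \<Rightarrow> real" where h0: "h0 > 0"
    and D: "\<forall>h\<in>{0<..h0}. \<forall>\<tau>\<in>{0..1}. \<forall>\<sigma>\<in>{0..1}. D 0 h \<tau> \<sigma> = kernel r (\<psi> h) \<tau> \<sigma>"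
    and cont: "continuous_on ({0..h0} \<times> {0..1} \<times> {0..1}) (\<lambda>(h, \<tau>, \<sigma>). D 0 h \<tau> \<sigma>)"
    using assms unfolding kernel_extends_smoothly_def by blast
  \<comment> \<open>The extension to \<open>h = 0\<close> makes the parameter set compact. This is
    the source of a bound uniform in \<open>h\<close>.\<close>
  have "compact ((\<lambda>(h, \<tau>, \<sigma>). D 0 h \<tau> \<sigma>) ` ({0..h0} \<times> {0..1} \<times> {0..1}))"
    by (intro compact_continuous_image cont compact_Times compact_Icc)
  from compact_imp_bounded[OF this]
  obtain K where K: "\<forall>x\<in>{0..h0} \<times> {0..1} \<times> {0..1}. norm (case x of (h, \<tau>, \<sigma>) \<Rightarrow> D 0 h \<tau> \<sigma>) \<le> K"
    unfolding bounded_iff by blast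
  have "\<forall>\<^sub>F h in at_right 0. \<forall>\<tau>\<in>{0..1}. \<forall>\<sigma>\<in>{0..1}. \<bar>kernel r (\<psi> h) \<tau> \<sigma>\<bar> \<le> K"
    using eventually_at_right_real[OF h0]
  proof eventually_elim
    case (elim h)
    show ?case
    proof (intro ballI)
      fix \<tau> \<sigma> :: real assume *: "\<tau> \<in> {0..1}" "\<sigma> \<in> {0..1}"
      then have "norm (D 0 h \<tau> \<sigma>) \<le> K"
        using elim bspec[OF K, of "(h, \<tau>, \<sigma>)"] by simp
      moreover have "D 0 h \<tau> \<sigma> = kernel r (\<psi> h) \<tau> \<sigma>"
        using D * elim by auto
      ultimately show "\<bar>kernel r (\<psi> h) \<tau> \<sigma>\<bar> \<le> K" by simp
    qed
  qed
  then show ?thesis by (rule that)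
qed

lemma continuous_on_kernel_scaleR:
  fixes w :: "real \<Rightarrow> 'a::real_normed_vector"
  assumes "\<forall>i<r. continuous_on S (\<psi> i)" and "continuous_on S w"
  shows "continuous_on S (\<lambda>\<sigma>. kernel r \<psi> \<tau> \<sigma> *\<^sub>R w \<sigma>)"
  unfolding kernel_def by (intro continuous_intros) (use assms in auto)

lemma proj_diff:
  assumes "\<forall>i<r. continuous_on {0..1} (\<psi> i)"
    and "continuous_on {0..1} v" and "continuous_on {0..1} w"
  shows "proj r \<psi> (\<lambda>\<tau>. v \<tau> - w \<tau>) \<tau> = proj r \<psi> v \<tau> - proj r \<psi> w \<tau>"
  unfolding proj_def scaleR_diff_right
  by (intro Henstock_Kurzweil_Integration.integral_diff integrable_continuous_interval
      continuous_on_kernel_scaleR assms)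

lemma norm_proj_le:
  assumes "\<forall>i<r. continuous_on {0..1} (\<psi> i)" and "continuous_on {0..1} w"
    and "\<And>\<sigma>. \<sigma> \<in> {0..1} \<Longrightarrow> \<bar>kernel r \<psi> \<tau> \<sigma>\<bar> \<le> K" and "\<And>\<sigma>. \<sigma> \<in> {0..1} \<Longrightarrow> norm (w \<sigma>) \<le> B"
  shows "norm (proj r \<psi> w \<tau>) \<le> K * B"
proof -
  have "K \<ge> 0"
    using assms(3)[of 0] by simp
  then have "norm (kernel r \<psi> \<tau> \<sigma> *\<^sub>R w \<sigma>) \<le> K * B" if "\<sigma> \<in> {0..1}" for \<sigma>
    unfolding norm_scaleR by (intro mult_mono assms(3,4) that) auto
  then have "norm (proj r \<psi> w \<tau>) \<le> K * B * (1 - 0)"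
    unfolding proj_def by (intro integral_bound continuous_on_kernel_scaleR assms) auto
  then show ?thesis by simp
qed

text \<open>With \<open>P\<close> the polynomial, split the difference of the projection of
  \<open>w\<close> and \<open>P\<close> into the projection of \<open>w - P\<close>, small by the
  kernel bound, and the projection defect of \<open>P\<close>, small because \<open>P\<close> is
  regular. The same \<open>p\<close> thus serves \<open>w\<close> and its projection.\<close>

lemma proj_graded_expansion:
  fixes w :: "real \<Rightarrow> real \<Rightarrow> real^'d"
  assumes kernel: "kernel_extends_smoothly r \<psi>" and acc: "projection_accurate TYPE('d) r \<psi>"
    and cont: "\<forall>\<^sub>F h in at_right 0. \<forall>i<r. continuous_on {0..1} (\<psi> h i)"
    and contw: "\<forall>\<^sub>F h in at_right 0. continuous_on {0..1} (w h)"
    and p: "\<And>i. graded_poly 0 (p i)" and w: "unif_bigo k (\<lambda>h \<tau>. w h \<tau> - (\<chi> i. p i h \<tau>))" and "k \<le> r"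
  shows "unif_bigo k (\<lambda>h \<tau>. proj r (\<psi> h) (w h) \<tau> - (\<chi> i. p i h \<tau>))"
proof -
  define P where "P h \<tau> = (\<chi> i. p i h \<tau>)" for h \<tau>
  have contP: "continuous_on {0..1} (P h)" for h
    unfolding P_def by (intro continuous_on_vec_lambda graded_poly_continuous[OF p])
  obtain K where K: "\<forall>\<^sub>F h in at_right 0. \<forall>\<tau>\<in>{0..1}. \<forall>\<sigma>\<in>{0..1}. \<bar>kernel r (\<psi> h) \<tau> \<sigma>\<bar> \<le> K"
    using kernel by (rule kernel_bounded)
  obtain C where C: "\<forall>\<^sub>F h in at_right 0. 0 < h \<and> h < 1 \<and> (\<forall>\<tau>\<in>{0..1}. norm (w h \<tau> - P h \<tau>) \<le> C * h ^ k)"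
    using w[folded P_def] by (rule unif_bigoE)
  have "\<forall>\<^sub>F h in at_right 0. h > 0 \<longrightarrow> h < 1 \<longrightarrow>
      (\<forall>\<tau>\<in>{0..1}. norm (proj r (\<psi> h) (w h) \<tau> - proj r (\<psi> h) (P h) \<tau>) \<le> (K * C) * h ^ k)"
    using K C cont contw
  proof eventually_elim
    case (elim h)
    have "norm (proj r (\<psi> h) (\<lambda>\<tau>. w h \<tau> - P h \<tau>) \<tau>) \<le> K * (C * h ^ k)" if "\<tau> \<in> {0..1}" for \<tau>
      using elim that by (intro norm_proj_le continuous_on_diff contP) auto
    then show ?case
      using proj_diff[OF elim(3,4) contP] by (simp add: mult.assoc)
  qed
  then have "unif_bigo k (\<lambda>h \<tau>. proj r (\<psi> h) (w h) \<tau> - proj r (\<psi> h) (P h) \<tau>)"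
    by (rule unif_bigoI)
  moreover have "unif_bigo r (\<lambda>h \<tau>. proj r (\<psi> h) (P h) \<tau> - P h \<tau>)"
    using acc graded_poly_regular[of p r, OF p] unfolding projection_accurate_def P_def by blast
  then have "unif_bigo k (\<lambda>h \<tau>. proj r (\<psi> h) (P h) \<tau> - P h \<tau>)"
    using \<open>k \<le> r\<close> by (rule unif_bigo_weaken)
  ultimately show ?thesis
    unfolding P_def[symmetric] using unif_bigo_add by fastforce
qed

text \<open>\<open>w\<close> and its projection share one polynomial up to order \<open>r\<close>,
  which cancels in the difference.\<close>

lemma projection_defect:
  fixes w :: "real \<Rightarrow> real \<Rightarrow> real^'d"
  assumes "kernel_extends_smoothly r \<psi>" and "projection_accurate TYPE('d) r \<psi>"
    and "\<forall>\<^sub>F h in at_right 0. \<forall>i<r. continuous_on {0..1} (\<psi> h i)"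
    and "\<forall>\<^sub>F h in at_right 0. continuous_on {0..1} (w h)" and w: "graded_expansion r w"
  shows "unif_bigo r (\<lambda>h \<tau>. w h \<tau> - proj r (\<psi> h) (w h) \<tau>)"
proof -
  obtain p where p: "\<And>i. graded_poly 0 (p i)" "unif_bigo r (\<lambda>h \<tau>. w h \<tau> - (\<chi> i. p i h \<tau>))"
    using w by (auto simp: graded_expansion_def)
  from unif_bigo_diff[OF p(2) proj_graded_expansion[OF assms(1-4) p order_refl]]
  show ?thesis by simp
qed

text \<open>Picard iteration: an expansion of \<open>u\<close> to order \<open>k\<close> gives one of \<open>A u + P\<^sub>h g(u)\<close>, and integrating
  \<open>u' = h (A u + P\<^sub>h g(u))\<close> over \<open>\<tau>\<close> gains one order in \<open>h\<close> and one degree in \<open>\<tau>\<close>.\<close>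

lemma ECr_graded_expansion:
  fixes A :: "real^'d^'d" and g :: "real^'d \<Rightarrow> real^'d"
  assumes g: "\<And>k i. Ck_on k UNIV (\<lambda>y. g y $ i)" and contg: "continuous_on UNIV g"
    and kernel: "kernel_extends_smoothly r \<psi>" "projection_accurate TYPE('d) r \<psi>"
    and cont: "\<forall>\<^sub>F h in at_right 0. \<forall>i<r. continuous_on {0..1} (\<psi> h i)"
    and sol: "\<forall>\<^sub>F h in at_right 0. ECr_solution r (\<psi> h) h A g y0 (u h)"
    and B: "\<forall>\<^sub>F h in at_right 0. \<forall>\<tau>\<in>{0..1}. norm (u h \<tau>) \<le> B"
  defines "v \<equiv> \<lambda>h \<tau>. A *v u h \<tau> + proj r (\<psi> h) (\<lambda>\<sigma>. g (u h \<sigma>)) \<tau>"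
  shows "graded_expansion r (\<lambda>h \<tau>. g (u h \<tau>))" and "graded_expansion r v"
proof -
  have contgu: "\<forall>\<^sub>F h in at_right 0. continuous_on {0..1} (\<lambda>\<tau>. g (u h \<tau>))"
    using cont sol
  proof eventually_elim
    case (elim h)
    show ?case
      by (rule continuous_on_compose2[OF contg ECr_continuous[OF elim]]) simp
  qed
  have gu: "graded_expansion k (\<lambda>h \<tau>. g (u h \<tau>))" and v: "graded_expansion k v"
    if u: "graded_expansion k u" and k: "k \<le> r" for k
  proof -
    show gu: "graded_expansion k (\<lambda>h \<tau>. g (u h \<tau>))"
      using g u B by (rule graded_expansion_compose)
    then obtain p where "\<And>i. graded_poly 0 (p i)" "unif_bigo k (\<lambda>h \<tau>. g (u h \<tau>) - (\<chi> i. p i h \<tau>))"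
      by (auto simp: graded_expansion_def)
    with proj_graded_expansion[OF kernel cont contgu _ _ k]
    have "graded_expansion k (\<lambda>h \<tau>. proj r (\<psi> h) (\<lambda>\<sigma>. g (u h \<sigma>)) \<tau>)"
      unfolding graded_expansion_def by blast
    with u show "graded_expansion k v"
      unfolding v_def by (intro graded_expansion_add graded_expansion_matrix_vector_mult)
  qed
  \<comment> \<open>The bound \<open>k \<le> r\<close> reflects the accuracy of the projection. The
    start is order 0, where the uniform bound on \<open>u\<close> suffices.\<close>
  have "k \<le> r \<Longrightarrow> graded_expansion k u" for k
  proof (induction k)
    case 0
    have "unif_bigo 0 u"
      by (rule unif_bigoI[where C = B]) (use B in \<open>auto elim!: eventually_mono\<close>)
    then show ?case
      unfolding graded_expansion_def
      by (intro exI[of _ "\<lambda>i h \<tau>. 0"]) (simp add: graded_poly.zero unif_bigo_vec_iff)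
  next
    case (Suc k)
    then have "graded_expansion k v" by (intro v) auto
    then obtain p where p: "\<And>i. graded_poly 0 (p i)" "unif_bigo k (\<lambda>h \<tau>. v h \<tau> - (\<chi> i. p i h \<tau>))"
      by (auto simp: graded_expansion_def)
    have "\<forall>i. \<exists>P. graded_poly 0 P \<and> (\<forall>h. P h 0 = 0) \<and>
        (\<forall>h \<tau>. (P h has_real_derivative h * p i h \<tau>) (at \<tau>))"
      by (intro allI graded_poly_time_antiderivative p)
    from choice[OF this] obtain P where P: "\<And>i. graded_poly 0 (P i)" "\<And>i h. P i h 0 = 0"
      "\<And>i h \<tau>. (P i h has_real_derivative h * p i h \<tau>) (at \<tau>)"
      by blast
    \<comment> \<open>\<open>P i\<close> vanishes at \<open>\<tau> = 0\<close>, so adding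
      \<open>y0 $ i\<close> matches the initial value of \<open>u\<close> for every
      \<open>h\<close>.\<close>
    have "unif_bigo (Suc k) (\<lambda>h \<tau>. u h \<tau> $ i - (P i h \<tau> + y0 $ i))" for i
    proof (rule unif_bigo_integrate_time)
      show "unif_bigo k (\<lambda>h \<tau>. v h \<tau> $ i - p i h \<tau>)"
        using p(2) by (simp add: unif_bigo_vec_iff)
      show "\<forall>\<^sub>F h in at_right 0. u h 0 $ i - (P i h 0 + y0 $ i) = 0 \<and>
          (\<forall>\<tau>\<in>{0..1}. ((\<lambda>\<tau>. u h \<tau> $ i - (P i h \<tau> + y0 $ i)) has_real_derivative
            h * (v h \<tau> $ i - p i h \<tau>)) (at \<tau> within {0..1}))"
        using cont sol
      proof eventually_elim
        case (elim h)
        have "((\<lambda>\<tau>. u h \<tau> $ i - (P i h \<tau> + y0 $ i)) has_real_derivative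
            h * (v h \<tau> $ i - p i h \<tau>)) (at \<tau> within {0..1})" if "\<tau> \<in> {0..1}" for \<tau>
        proof -
          have "((\<lambda>\<tau>. u h \<tau> $ i) has_vector_derivative (h *\<^sub>R v h \<tau>) $ i) (at \<tau> within {0..1})"
            using ECr_ode[OF elim that] unfolding v_def
            by (rule bounded_linear.has_vector_derivative[OF bounded_linear_vec_nth])
          then have "((\<lambda>\<tau>. u h \<tau> $ i) has_real_derivative h * v h \<tau> $ i) (at \<tau> within {0..1})"
            by (simp add: has_real_derivative_iff_has_vector_derivative)
          from DERIV_diff[OF this DERIV_add[OF has_field_derivative_at_within[OF P(3)] DERIV_const]]
          show ?thesis by (simp add: right_diff_distrib)
        qed
        then show ?case
          using ECr_initial[OF elim(2)] P(2) by simp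
      qed
    qed
    then show ?case
      unfolding graded_expansion_def
      by (intro exI[of _ "\<lambda>i h \<tau>. P i h \<tau> + y0 $ i"])
        (simp add: unif_bigo_vec_iff graded_poly_add[OF P(1) graded_poly_const])
  qed
  then show "graded_expansion r (\<lambda>h \<tau>. g (u h \<tau>))" and "graded_expansion r v"
    by (auto intro: gu v)
qed

section \<open>The energy estimate of order \<open>2 r + 1\<close> and the theorem\<close>

lemma energy_defect_order:
  fixes Q M :: "real^'d^'d" and V :: "real^'d \<Rightarrow> real"
  defines "g \<equiv> (\<lambda>y. Q *v grad V y)"
  assumes Q: "invertible Q" "transpose M = M" "\<forall>y. V differentiable (at y)" "\<forall>x. x \<bullet> (Q *v x) \<le> 0"
    and g: "\<And>k i. Ck_on k UNIV (\<lambda>y. g y $ i)" and contg: "continuous_on UNIV g"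
    and kernel: "kernel_extends_smoothly r \<psi>" "projection_accurate TYPE('d) r \<psi>"
    and ortho: "\<forall>\<^sub>F h in at_right 0. orthonormal_basis r \<phi> h (\<psi> h)"
    and cont: "\<forall>\<^sub>F h in at_right 0. \<forall>i<r. continuous_on {0..1} (\<psi> h i)"
    and sol: "\<forall>\<^sub>F h in at_right 0. ECr_solution r (\<psi> h) h (Q ** M) g y0 (u h)"
    and B: "\<forall>\<^sub>F h in at_right 0. \<forall>\<tau>\<in>{0..1}. norm (u h \<tau>) \<le> B"
  shows "\<exists>C. \<forall>\<^sub>F h in at_right 0. energy M V (u h 1) \<le> energy M V y0 + C * h ^ (2 * r + 1)"
proof -
  define p where "p h \<tau> = proj r (\<psi> h) (\<lambda>\<sigma>. g (u h \<sigma>)) \<tau>" for h \<tau>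
  define z where "z h \<tau> = transpose (matrix_inv Q) *v ((Q ** M) *v u h \<tau> + p h \<tau>)" for h \<tau>
  note exp = ECr_graded_expansion[OF g contg kernel cont sol B, folded p_def]
  have contgz: "\<forall>\<^sub>F h in at_right 0. continuous_on {0..1} (\<lambda>\<tau>. g (u h \<tau>)) \<and> continuous_on {0..1} (z h)"
    using cont sol
  proof eventually_elim
    case (elim h)
    have int: "\<forall>i<r. (\<lambda>\<sigma>. \<psi> h i \<sigma> *\<^sub>R g (u h \<sigma>)) integrable_on {0..1}"
      by (rule elim(2)[unfolded ECr_solution_def, THEN conjunct1])
    have "continuous_on {0..1} (z h)"
      unfolding z_def p_def
      by (intro continuous_on_add continuous_on_proj[OF elim(1) int] ECr_continuous[OF elim]
          bounded_linear.continuous_on[OF matrix_vector_mul_bounded_linear])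
    moreover have "continuous_on {0..1} (\<lambda>\<tau>. g (u h \<tau>))"
      by (rule continuous_on_compose2[OF contg ECr_continuous[OF elim]]) simp
    ultimately show ?case by blast
  qed
  then have contg: "\<forall>\<^sub>F h in at_right 0. continuous_on {0..1} (\<lambda>\<tau>. g (u h \<tau>))"
    and contz: "\<forall>\<^sub>F h in at_right 0. continuous_on {0..1} (z h)"
    by (auto elim: eventually_mono)
  have "graded_expansion r z"
    unfolding z_def by (rule graded_expansion_matrix_vector_mult[OF exp(2)])
  then have "unif_bigo r (\<lambda>h \<tau>. z h \<tau> - proj r (\<psi> h) (z h) \<tau>)"
    by (rule projection_defect[OF kernel cont contz])
  then obtain C1 where "C1 \<ge> 0" and C1: "\<forall>\<^sub>F h in at_right 0. 0 < h \<and> h < 1 \<and>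
      (\<forall>\<tau>\<in>{0..1}. norm (z h \<tau> - proj r (\<psi> h) (z h) \<tau>) \<le> C1 * h ^ r)"
    by (rule unif_bigoE)
  have "unif_bigo r (\<lambda>h \<tau>. g (u h \<tau>) - p h \<tau>)"
    unfolding p_def
    by (rule projection_defect[OF kernel cont contg exp(1)])
  then obtain C2 where C2: "\<forall>\<^sub>F h in at_right 0. 0 < h \<and> h < 1 \<and>
      (\<forall>\<tau>\<in>{0..1}. norm (g (u h \<tau>) - p h \<tau>) \<le> C2 * h ^ r)"
    by (rule unif_bigoE)
  have "\<forall>\<^sub>F h in at_right 0. energy M V (u h 1) \<le> energy M V y0 + (C1 * C2) * h ^ (2 * r + 1)"
    using ortho cont sol contz C1 C2
  proof eventually_elim
    case (elim h)
    then have h: "h > 0" by blast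
    define d where "d \<tau> = (z h \<tau> - proj r (\<psi> h) (z h) \<tau>) \<bullet> (g (u h \<tau>) - p h \<tau>)" for \<tau>
    have "\<forall>i<r. (\<lambda>\<sigma>. \<psi> h i \<sigma> *\<^sub>R z h \<sigma>) integrable_on {0..1}"
      using elim(2,4) by (auto intro!: integrable_continuous_interval continuous_intros)
    note proj_z = proj_eq[OF this]
    have d: "d integrable_on {0..1}"
      and le: "energy M V (u h 1) \<le> energy M V y0 + h * integral {0..1} d"
      \<comment> \<open>Writing the projection of \<open>z\<close> in the basis instantiates the
        free \<open>W\<close> of \<open>energy_defect\<close> with its coefficients. Both factors of
        \<open>d\<close> are thereby projection defects.\<close>
      unfolding d_def proj_z unfolding z_def p_def g_def
      by (rule energy_defect[OF Q h elim(1,2) elim(3)[unfolded g_def]])+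
    have "d \<tau> \<le> C1 * C2 * h ^ (2 * r)" if "\<tau> \<in> {0..1}" for \<tau>
    proof -
      have "d \<tau> \<le> norm (z h \<tau> - proj r (\<psi> h) (z h) \<tau>) * norm (g (u h \<tau>) - p h \<tau>)"
        unfolding d_def by (rule norm_cauchy_schwarz)
      also have "\<dots> \<le> (C1 * h ^ r) * (C2 * h ^ r)"
        using elim(5,6) that \<open>C1 \<ge> 0\<close> by (intro mult_mono) auto
      also have "\<dots> = C1 * C2 * h ^ (2 * r)"
        by (simp add: mult_2 power_add)
      finally show ?thesis .
    qed
    then have "integral {0..1} d \<le> integral {0..1} (\<lambda>\<tau>::real. C1 * C2 * h ^ (2 * r))"
      by (intro integral_le d) auto
    then have "h * integral {0..1} d \<le> h * (C1 * C2 * h ^ (2 * r))"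
      using h by simp
    with le show ?case by (simp add: mult_ac)
  qed
  then show ?thesis by blast
qed

text \<open>Component \<open>i\<close> is the derivative of \<open>V\<close> in the direction of row
  \<open>i\<close> of \<open>Q\<close>, and \<open>Ck_on\<close> is defined by such directional
  derivatives, so one order is spent and nothing else has to be shown.\<close>

lemma Cinf_grad_component:
  fixes Q :: "real^'d^'d"
  assumes "Cinf_on UNIV V"
  shows "Ck_on k UNIV (\<lambda>y. (Q *v grad V y) $ i)"
proof -
  have "Ck_on (Suc k) UNIV V"
    using assms unfolding Cinf_on_def by blast
  then obtain V' where V': "\<And>x. (V has_derivative V' x) (at x)" and Ck: "\<And>v. Ck_on k UNIV (\<lambda>x. V' x v)"
    by auto
  have "(Q *v grad V y) $ i = V' y (Q $ i)" for y
  proof -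
    have "V differentiable (at y)"
      using V' by (auto simp: differentiable_def)
    then have "(\<lambda>x. x \<bullet> grad V y) = V' y"
      using GDERIV_grad V' unfolding gderiv_def by (blast intro: has_derivative_unique)
    then show ?thesis
      by (metis matrix_vector_mul_component)
  qed
  with Ck show ?thesis by simp
qed

theorem theorem2:
  fixes Q M :: "real^'d^'d" and V :: "real^'d \<Rightarrow> real" and y0 :: "real^'d"
    and r :: nat and \<phi> :: "nat \<Rightarrow> real \<Rightarrow> real"
  defines "A \<equiv> Q ** M" and "g \<equiv> (\<lambda>y. Q *v grad V y)" and "H \<equiv> energy M V"
  assumes "invertible Q"
    and "transpose M = M"
    and "\<forall>y. V differentiable (at y)"
    and "\<forall>x. x \<bullet> (Q *v x) \<le> 0"
    and "r \<ge> 1"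
    and "\<forall>i<r. Cinf_on {0..} (\<phi> i)"
  shows "(\<forall>h \<psi> X u.
        h > 0 \<longrightarrow> lin_indep r (\<lambda>i. rescale h (\<phi> i)) \<longrightarrow> orthonormal_basis r \<phi> h \<psi> \<longrightarrow>
        is_Xspace r \<phi> h X \<longrightarrow> ECr_solution r \<psi> h A g y0 u \<longrightarrow>
        u \<in> X \<longrightarrow> H (u 1) \<le> H y0)
    \<and> (\<forall>h1 R \<psi> X u.
        Cinf_on UNIV V \<longrightarrow> h1 > 0 \<longrightarrow> R > 0 \<longrightarrow>
        (\<forall>h\<in>{0<..<h1}.
          lin_indep r (\<lambda>i. rescale h (\<phi> i)) \<and> orthonormal_basis r \<phi> h (\<psi> h) \<and>
          is_Xspace r \<phi> h (X h) \<and> ECr_solution r (\<psi> h) h A g y0 (u h) \<and>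
          (\<forall>\<tau>\<in>{0..1}. u h \<tau> \<in> ball (mexp ((\<tau> * h) *\<^sub>R A) *v y0) R)) \<longrightarrow>
        kernel_extends_smoothly r \<psi> \<longrightarrow> projection_accurate TYPE('d) r \<psi> \<longrightarrow>
        (\<exists>\<epsilon>. \<epsilon> \<in> O[at_right 0](\<lambda>h. h ^ (2 * r + 1)) \<and>
          (\<forall>\<^sub>F h in at_right 0. u h \<notin> X h \<longrightarrow> H (u h 1) \<le> H y0 + \<epsilon> h)))"
proof -
  have cont: "\<forall>i<r. continuous_on {0..1} (\<psi> i)" if "orthonormal_basis r \<phi> h \<psi>" "h > 0" for h \<psi>
    using orthonormal_basis_continuous[OF that(1) assms(9) that(2)] by blast
  show ?thesis
  proof (intro conjI allI impI)
    fix h \<psi> X u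
    assume h: "h > 0" and ortho: "orthonormal_basis r \<phi> h \<psi>" and X: "is_Xspace r \<phi> h X" "u \<in> X"
      and sol: "ECr_solution r \<psi> h A g y0 u"
    show "H (u 1) \<le> H y0"
      unfolding H_def
      by (rule energy_nonincreasing_in_Xspace[OF assms(4-7) h ortho cont[OF ortho h]
          sol[unfolded A_def g_def] X])
  next
    fix h1 R \<psi> u and X :: "real \<Rightarrow> (real \<Rightarrow> real^'d) set"
    assume smooth: "Cinf_on UNIV V" and h1: "h1 > 0"
      and step: "\<forall>h\<in>{0<..<h1}. lin_indep r (\<lambda>i. rescale h (\<phi> i)) \<and> orthonormal_basis r \<phi> h (\<psi> h) \<and>
          is_Xspace r \<phi> h (X h) \<and> ECr_solution r (\<psi> h) h A g y0 (u h) \<and>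
          (\<forall>\<tau>\<in>{0..1}. u h \<tau> \<in> ball (mexp ((\<tau> * h) *\<^sub>R A) *v y0) R)"
      and kernel: "kernel_extends_smoothly r \<psi>" "projection_accurate TYPE('d) r \<psi>"
    have ev: "\<forall>\<^sub>F h in at_right 0. h \<in> {0<..<h1}"
      using h1 by (rule eventually_at_right_real)
    have Ck: "Ck_on k UNIV (\<lambda>y. (Q *v grad V y) $ i)" for k i
      using smooth by (rule Cinf_grad_component)
    have contg: "continuous_on UNIV (\<lambda>y. Q *v grad V y)"
      using continuous_on_vec_lambda[of UNIV "\<lambda>i y. (Q *v grad V y) $ i"] Ck[of 0] by simp
    \<comment> \<open>For \<open>h < 1\<close> all centres of the balls lie on this compact arc,
      which turns the fixed radius \<open>R\<close> into a bound on \<open>u\<close> uniform in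
      \<open>h\<close>.\<close>
    have "compact ((\<lambda>t. mexp (t *\<^sub>R A) *v y0) ` {0..1})"
      by (intro compact_continuous_image continuous_on_matrix_vector_mult continuous_on_mexp
          continuous_intros) auto
    from compact_imp_bounded[OF this] obtain B
      where B: "\<forall>t\<in>{0..1}. norm (mexp (t *\<^sub>R A) *v y0) \<le> B"
      unfolding bounded_iff by blast
    have bound: "\<forall>\<^sub>F h in at_right 0. \<forall>\<tau>\<in>{0..1}. norm (u h \<tau>) \<le> B + R"
      using ev eventually_at_right_real[OF zero_less_one]
    proof eventually_elim
      case (elim h)
      show ?case
      proof
        fix \<tau> :: real assume \<tau>: "\<tau> \<in> {0..1}"
        have "norm (mexp ((\<tau> * h) *\<^sub>R A) *v y0) \<le> B"
          using \<tau> elim(2) by (intro B[rule_format]) (auto intro: mult_le_one)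
        moreover have "dist (mexp ((\<tau> * h) *\<^sub>R A) *v y0) (u h \<tau>) < R"
          using step elim(1) \<tau> by (meson mem_ball)
        ultimately show "norm (u h \<tau>) \<le> B + R"
          using norm_triangle_sub[of "u h \<tau>" "mexp ((\<tau> * h) *\<^sub>R A) *v y0"]
          by (simp add: dist_norm norm_minus_commute)
      qed
    qed
    have ortho: "\<forall>\<^sub>F h in at_right 0. orthonormal_basis r \<phi> h (\<psi> h)"
      and sol: "\<forall>\<^sub>F h in at_right 0. ECr_solution r (\<psi> h) h (Q ** M) (\<lambda>y. Q *v grad V y) y0 (u h)"
      using step by (auto simp: A_def g_def intro: eventually_mono[OF ev])
    have "\<forall>\<^sub>F h in at_right 0. \<forall>i<r. continuous_on {0..1} (\<psi> h i)"
      using ev ortho by eventually_elim (rule cont, auto)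
    from energy_defect_order[OF assms(4-7) Ck contg kernel ortho this sol bound]
    obtain C where C: "\<forall>\<^sub>F h in at_right 0. energy M V (u h 1) \<le> energy M V y0 + C * h ^ (2 * r + 1)"
      by blast
    show "\<exists>\<epsilon>. \<epsilon> \<in> O[at_right 0](\<lambda>h. h ^ (2 * r + 1)) \<and>
        (\<forall>\<^sub>F h in at_right 0. u h \<notin> X h \<longrightarrow> H (u h 1) \<le> H y0 + \<epsilon> h)"
    proof (intro exI[of _ "\<lambda>h. C * h ^ (2 * r + 1)"] conjI)
      show "(\<lambda>h. C * h ^ (2 * r + 1)) \<in> O[at_right 0](\<lambda>h. h ^ (2 * r + 1))"
        by (intro bigoI[of _ "\<bar>C\<bar>"] always_eventually) (simp add: abs_mult)
      show "\<forall>\<^sub>F h in at_right 0. u h \<notin> X h \<longrightarrow> H (u h 1) \<le> H y0 + C * h ^ (2 * r + 1)"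
        using C by eventually_elim (simp add: H_def)
    qed
  qed
qed

end
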